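(* Let $N\ge 1$. If the operator $\Theta:T(M)\to T^*(M)$ is symplectic, then the operator $\hat{\Theta}_N:T(\hat{M}_N)\to T^*(\hat{M}_N)$ defined by the block matrix $$\hat{\Theta}_N(\hat{\eta}_N)=\left[\frac{1}{(N-i-j)!}\left.\frac{\partial^{N-i-j}\Theta(\hat u_N)}{\partial\varepsilon^{N-i-j}}\right|_{\varepsilon=0}\right]_{i,j=0,1,\dots,N},$$ where blocks with $i+j>N$ are zero (so the blocks with $i+j=N$ are $\Theta(\eta_0)$) and $\hat u_N=\sum_{i=0}^N\varepsilon^i\eta_i$, is symplectic too.
   Context: Setting. $M=M(u)$ is a manifold with variable $u$, a column vector with $q$ components (typically functions); it is treated as a linear space, so that $u+\varepsilon S$ makes sense, tangent vectors at all points lie in one fixed space $E$ and cotangent vectors in one fixed space $E^*$, with a nondegenerate duality pairing $\langle\cdot,\cdot\rangle$ between cotangent and tangent vectors (written in either order). $\hat M_N=\hat M_N(\hat\eta_N)$ is the analogous manifold with variable $\hat\eta_N=(\eta_0^T,\dots,\eta_N^T)^T$, each $\eta_i$ being of the same kind and dimension as $u$; its tangent (cotangent) vectors are $(N+1)$-tuples of elements of $E$ (of $E^*$), the pairing is the sum of the componentwise pairings, and operators are $(N+1)\times(N+1)$ block matrices. $T(\cdot)$, $T^*(\cdot)$ denote tangent and cotangent bundles (membership means being a field). A linear operator $\Theta:T(M)\to T^*(M)$ assigns to each $u$ a linear map $\Theta(u)$ from tangent to cotangent vectors. All objects are assumed smooth, with as many derivatives as needed. Gateaux derivative: $X'(u)[S(u)]=\left.\frac{\partial}{\partial\varepsilon}X(u+\varepsilon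 S(u))\right|_{\varepsilon=0}$. A linear operator $\Theta:T(M)\to T^*(M)$ is symplectic if it is skew-symmetric, $\langle\Theta(u)K(u),S(u)\rangle=-\langle\Theta(u)S(u),K(u)\rangle$ for all $K,S\in T(M)$, and for all $K,S,T\in T(M)$ $$\langle K(u),\Theta'(u)[S(u)]T(u)\rangle+\mathrm{cycle}(K,S,T)=0,$$ where $\mathrm{cycle}$ denotes the two terms obtained by cyclic permutation. The same definition applies on $\hat M_N$. *)

theory Defs
  imports "HOL-Analysis.Analysis"
begin

text \<open>
  The manifold is treated as a linear space, of function type and so not necessarily normable:
  it is modelled by a Hausdorff locally convex real topological vector space.
\<close>

class lctvs = real_vector + topological_ab_group_add + t2_space +
  assumes tendsto_scaleR_Pair:
    "filterlim (\<lambda>p. fst p *\<^sub>R snd p) (nhds (a *\<^sub>R x)) (nhds (a :: real) \<times>\<^sub>F nhds x)"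
    and locally_convex_raw: (* convexity written out: convex cannot be used in the class body *)
      "open U \<Longrightarrow> 0 \<in> U \<Longrightarrow> \<exists>W. open W \<and> 0 \<in> W \<and> W \<subseteq> U \<and>
        (\<forall>x\<in>W. \<forall>y\<in>W. \<forall>s\<ge>0. \<forall>t\<ge>0. s + t = 1 \<longrightarrow> s *\<^sub>R x + t *\<^sub>R y \<in> W)"

lemma locally_convex_0:
  fixes U :: "'a::lctvs set"
  shows "open U \<Longrightarrow> 0 \<in> U \<Longrightarrow> \<exists>W. open W \<and> 0 \<in> W \<and> W \<subseteq> U \<and> convex W"
  using locally_convex_raw[of U] unfolding convex_def by blast

instance real_normed_vector \<subseteq> lctvs
proof
  fix a :: real and x :: 'a
  show "filterlim (\<lambda>p. fst p *\<^sub>R snd p) (nhds (a *\<^sub>R x)) (nhds a \<times>\<^sub>F nhds x)"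
    by (intro tendsto_scaleR filterlim_fst filterlim_snd)
next
  fix U :: "'a set"
  assume "open U" "0 \<in> U"
  then obtain e where "e > 0" "ball 0 e \<subseteq> U"
    by (meson openE)
  then have "\<exists>W. open W \<and> 0 \<in> W \<and> W \<subseteq> U \<and> convex W"
    by (intro exI[of _ "ball 0 e"]) auto
  then show "\<exists>W. open W \<and> 0 \<in> W \<and> W \<subseteq> U \<and>
      (\<forall>x\<in>W. \<forall>y\<in>W. \<forall>s\<ge>0. \<forall>t\<ge>0. s + t = 1 \<longrightarrow> s *\<^sub>R x + t *\<^sub>R y \<in> W)"
    by (simp add: convex_def)
qed

instance prod :: (topological_monoid_add, topological_monoid_add) topological_monoid_add
proof
  fix a b :: "'a \<times> 'b"
  have 1: "filterlim fst (nhds a) (nhds a \<times>\<^sub>F nhds b)" "filterlim snd (nhds b) (nhds a \<times>\<^sub>F nhds b)"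
    by (rule filterlim_fst filterlim_snd)+
  have "((\<lambda>x. (fst (fst x) + fst (snd x), snd (fst x) + snd (snd x)))
      \<longlongrightarrow> (fst a + fst b, snd a + snd b)) (nhds a \<times>\<^sub>F nhds b)"
    by (intro tendsto_Pair tendsto_add tendsto_fst tendsto_snd 1)
  then show "filterlim (\<lambda>x. fst x + snd x) (nhds (a + b)) (nhds a \<times>\<^sub>F nhds b)"
    by (simp add: plus_prod_def)
qed

instance prod :: (topological_comm_monoid_add, topological_comm_monoid_add) topological_comm_monoid_add ..

instance prod :: (topological_group_add, topological_group_add) topological_group_add
proof
  fix a :: "'a \<times> 'b"
  have "((\<lambda>x. (- fst x, - snd x)) \<longlongrightarrow> (- fst a, - snd a)) (nhds a)"
    by (intro tendsto_Pair tendsto_minus tendsto_fst tendsto_snd tendsto_ident_at filterlim_ident)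
  then show "filterlim uminus (nhds (- a)) (nhds a)"
    by (simp add: uminus_prod_def[abs_def] uminus_prod_def)
qed

instance prod :: (topological_ab_group_add, topological_ab_group_add) topological_ab_group_add ..

instance prod :: (lctvs, lctvs) lctvs
proof
  fix a :: real and x :: "'a \<times> 'b"
  have 1: "filterlim fst (nhds a) (nhds a \<times>\<^sub>F nhds x)" "filterlim snd (nhds x) (nhds a \<times>\<^sub>F nhds x)"
    by (rule filterlim_fst filterlim_snd)+
  have S: "((\<lambda>p. f p *\<^sub>R g p) \<longlongrightarrow> l *\<^sub>R m) F"
    if "(f \<longlongrightarrow> l) F" "(g \<longlongrightarrow> m) F" for f and g :: "_ \<Rightarrow> 'c::lctvs" and l m F
    using filterlim_compose[OF tendsto_scaleR_Pair filterlim_Pair[OF that]] by simp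
  have "((\<lambda>p. (fst p *\<^sub>R fst (snd p), fst p *\<^sub>R snd (snd p)))
      \<longlongrightarrow> (a *\<^sub>R fst x, a *\<^sub>R snd x)) (nhds a \<times>\<^sub>F nhds x)"
    using S[OF 1(1) tendsto_fst[OF 1(2)]] S[OF 1(1) tendsto_snd[OF 1(2)]]
    by (intro tendsto_Pair) auto
  then show "filterlim (\<lambda>p. fst p *\<^sub>R snd p) (nhds (a *\<^sub>R x)) (nhds a \<times>\<^sub>F nhds x)"
    by (simp add: scaleR_prod_def)
next
  fix U :: "('a \<times> 'b) set"
  assume "open U" "0 \<in> U"
  then obtain A B where "open A" "open B" "0 \<in> A \<times> B" "A \<times> B \<subseteq> U"
    by (rule open_prod_elim)
  moreover from this obtain V W where
    "open V" "0 \<in> V" "V \<subseteq> A" "convex V" "open W" "0 \<in> W" "W \<subseteq> B" "convex W"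
    using locally_convex_0[of A] locally_convex_0[of B] by (auto simp: zero_prod_def)
  ultimately have "\<exists>W. open W \<and> 0 \<in> W \<and> W \<subseteq> U \<and> convex W"
    by (intro exI[of _ "V \<times> W"]) (auto simp: open_Times convex_Times zero_prod_def)
  then show "\<exists>W. open W \<and> 0 \<in> W \<and> W \<subseteq> U \<and>
      (\<forall>x\<in>W. \<forall>y\<in>W. \<forall>s\<ge>0. \<forall>t\<ge>0. s + t = 1 \<longrightarrow> s *\<^sub>R x + t *\<^sub>R y \<in> W)"
    by (simp add: convex_def)
qed

instance vec :: (topological_monoid_add, finite) topological_monoid_add
proof
  fix a b :: "'a ^ 'b"
  have 1: "filterlim fst (nhds a) (nhds a \<times>\<^sub>F nhds b)" "filterlim snd (nhds b) (nhds a \<times>\<^sub>F nhds b)"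
    by (rule filterlim_fst filterlim_snd)+
  have "((\<lambda>x. \<chi> i. fst x $ i + snd x $ i) \<longlongrightarrow> (\<chi> i. a $ i + b $ i)) (nhds a \<times>\<^sub>F nhds b)"
    by (intro tendsto_vec_lambda tendsto_add tendsto_vec_nth 1)
  then show "filterlim (\<lambda>x. fst x + snd x) (nhds (a + b)) (nhds a \<times>\<^sub>F nhds b)"
    by (simp add: plus_vec_def)
qed

instance vec :: (topological_comm_monoid_add, finite) topological_comm_monoid_add ..

instance vec :: (topological_group_add, finite) topological_group_add
proof
  fix a :: "'a ^ 'b"
  have "((\<lambda>x. \<chi> i. - (x $ i)) \<longlongrightarrow> (\<chi> i. - (a $ i))) (nhds a)"
    by (intro tendsto_vec_lambda tendsto_minus tendsto_vec_nth filterlim_ident)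
  then show "filterlim uminus (nhds (- a)) (nhds a)"
    by (simp add: uminus_vec_def[abs_def] uminus_vec_def)
qed

instance vec :: (topological_ab_group_add, finite) topological_ab_group_add ..

instance vec :: (t0_space, finite) t0_space
proof
  fix a b :: "'a ^ 'b"
  assume "a \<noteq> b"
  then obtain i where "a $ i \<noteq> b $ i"
    by (auto simp: vec_eq_iff)
  then obtain U where "open U" "\<not> (a $ i \<in> U \<longleftrightarrow> b $ i \<in> U)"
    using separation_t0[of "a $ i" "b $ i"] by blast
  then show "\<exists>U. open U \<and> \<not> (a \<in> U \<longleftrightarrow> b \<in> U)"
    by (intro exI[of _ "(\<lambda>x. x $ i) -` U"]) (auto simp: open_vimage_vec_nth)
qed

instance vec :: (t1_space, finite) t1_space
proof
  fix a b :: "'a ^ 'b"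
  assume "a \<noteq> b"
  then obtain i where "a $ i \<noteq> b $ i"
    by (auto simp: vec_eq_iff)
  then obtain U where "open U" "a $ i \<in> U" "b $ i \<notin> U"
    using separation_t1[of "a $ i" "b $ i"] by blast
  then show "\<exists>U. open U \<and> a \<in> U \<and> b \<notin> U"
    by (intro exI[of _ "(\<lambda>x. x $ i) -` U"]) (auto simp: open_vimage_vec_nth)
qed

instance vec :: (t2_space, finite) t2_space
proof
  fix a b :: "'a ^ 'b"
  assume "a \<noteq> b"
  then obtain i where "a $ i \<noteq> b $ i"
    by (auto simp: vec_eq_iff)
  then obtain U V where "open U" "open V" "a $ i \<in> U" "b $ i \<in> V" "U \<inter> V = {}"
    using hausdorff[of "a $ i" "b $ i"] by blast
  then show "\<exists>U V. open U \<and> open V \<and> a \<in> U \<and> b \<in> V \<and> U \<inter> V = {}"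
    by (intro exI[of _ "(\<lambda>x. x $ i) -` U"] exI[of _ "(\<lambda>x. x $ i) -` V"])
      (auto simp: open_vimage_vec_nth)
qed

instance vec :: (lctvs, finite) lctvs
proof
  fix a :: real and x :: "'a ^ 'b"
  have 1: "filterlim fst (nhds a) (nhds a \<times>\<^sub>F nhds x)" "filterlim snd (nhds x) (nhds a \<times>\<^sub>F nhds x)"
    by (rule filterlim_fst filterlim_snd)+
  have "((\<lambda>p. fst p *\<^sub>R (snd p $ i)) \<longlongrightarrow> a *\<^sub>R (x $ i)) (nhds a \<times>\<^sub>F nhds x)" for i
    using filterlim_compose[OF tendsto_scaleR_Pair filterlim_Pair[OF 1(1) tendsto_vec_nth[OF 1(2)]]]
    by simp
  then have "((\<lambda>p. \<chi> i. fst p *\<^sub>R (snd p $ i)) \<longlongrightarrow> (\<chi> i. a *\<^sub>R (x $ i))) (nhds a \<times>\<^sub>F nhds x)"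
    by (intro tendsto_vec_lambda)
  then show "filterlim (\<lambda>p. fst p *\<^sub>R snd p) (nhds (a *\<^sub>R x)) (nhds a \<times>\<^sub>F nhds x)"
    by (simp add: scaleR_vec_def)
next
  fix U :: "('a ^ 'b) set"
  assume "open U" "0 \<in> U"
  then have "\<exists>A. (\<forall>i. open (A i) \<and> (0 :: 'a ^ 'b) $ i \<in> A i) \<and> (\<forall>y. (\<forall>i. y $ i \<in> A i) \<longrightarrow> y \<in> U)"
    unfolding open_vec_def by blast
  then obtain A where A: "\<And>i. open (A i)" "\<And>i. 0 \<in> A i" "{x. \<forall>i. x $ i \<in> A i} \<subseteq> U"
    by (auto simp: zero_index)
  have "\<exists>W. open W \<and> 0 \<in> W \<and> W \<subseteq> A i \<and> convex W" for i
    using A locally_convex_0 by blast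
  then obtain W where W: "\<And>i. open (W i) \<and> 0 \<in> W i \<and> W i \<subseteq> A i \<and> convex (W i)"
    by metis
  have "convex {x. \<forall>i. x $ i \<in> W i}"
    using W by (auto simp: convex_def)
  then have "\<exists>W. open W \<and> 0 \<in> W \<and> W \<subseteq> U \<and> convex W"
    using W subset_trans[OF _ A(3), of "{x. \<forall>i. x $ i \<in> W i}"]
    by (intro exI[of _ "{x. \<forall>i. x $ i \<in> W i}"]) (auto intro!: open_vector_box)
  then show "\<exists>W. open W \<and> 0 \<in> W \<and> W \<subseteq> U \<and>
      (\<forall>x\<in>W. \<forall>y\<in>W. \<forall>s\<ge>0. \<forall>t\<ge>0. s + t = 1 \<longrightarrow> s *\<^sub>R x + t *\<^sub>R y \<in> W)"
    by (simp add: convex_def)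
qed

text \<open>
  The library derivatives presuppose a norm, hence the derivative of a curve as a limit of
  difference quotients.  The value is meaningful only when the limit exists, which is what
  \<open>smooth\<close> below guarantees.
\<close>

definition curve_deriv :: "(real \<Rightarrow> 'a::lctvs) \<Rightarrow> real \<Rightarrow> 'a" where
  "curve_deriv c t = Lim (at 0) (\<lambda>h. (c (t + h) - c t) /\<^sub>R h)"

definition curve_differentiable :: "(real \<Rightarrow> 'a::lctvs) \<Rightarrow> real \<Rightarrow> bool" where
  "curve_differentiable c t \<longleftrightarrow> (\<exists>d. ((\<lambda>h. (c (t + h) - c t) /\<^sub>R h) \<longlongrightarrow> d) (at 0))"

definition gateaux :: "('a::lctvs \<Rightarrow> 'b::lctvs) \<Rightarrow> 'a \<Rightarrow> 'a \<Rightarrow> 'b" where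
  "gateaux X u v = curve_deriv (\<lambda>\<epsilon>. X (u + \<epsilon> *\<^sub>R v)) 0"

primrec iter_gateaux :: "('a::lctvs \<Rightarrow> 'b::lctvs) \<Rightarrow> 'a list \<Rightarrow> 'a \<Rightarrow> 'b" where
  "iter_gateaux X [] = X"
| "iter_gateaux X (v # vs) = (\<lambda>u. gateaux (iter_gateaux X vs) u v)"

text \<open>
  Smoothness in the sense of Michal--Bastiani (also used by Hamilton and Milnor): all iterated
  directional derivatives exist and are jointly continuous in the point and the directions.  The
  \<open>k\<close> directions are the first \<open>k\<close> entries of a sequence, so that the order need not be
  reflected in the type.
\<close>

definition smooth :: "('a::lctvs \<Rightarrow> 'b::lctvs) \<Rightarrow> bool" where
  "smooth X \<longleftrightarrow>
    (\<forall>vs u v. curve_differentiable (\<lambda>\<epsilon>. iter_gateaux X vs (u + \<epsilon> *\<^sub>R v)) 0) \<and>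
    (\<forall>k. continuous_on UNIV (\<lambda>(u, w :: nat \<Rightarrow> 'a). iter_gateaux X (map w [0..<k]) u))"

definition duality_pairing :: "('f::lctvs \<Rightarrow> 'e::lctvs \<Rightarrow> real) \<Rightarrow> bool" where
  "duality_pairing p \<longleftrightarrow>
    bilinear p \<and>
    (\<forall>\<xi>. continuous_on UNIV (p \<xi>)) \<and> (\<forall>S. continuous_on UNIV (\<lambda>\<xi>. p \<xi> S)) \<and>
    (\<forall>\<xi>. (\<forall>S. p \<xi> S = 0) \<longrightarrow> \<xi> = 0) \<and> (\<forall>S. (\<forall>\<xi>. p \<xi> S = 0) \<longrightarrow> S = 0)"

text \<open>
  The tangent (cotangent) bundle of the linear space \<open>'e\<close> is \<open>'e \<times> 'e\<close> (\<open>'e \<times> 'f\<close>), and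
  \<open>p \<xi> S\<close> is the pairing of a cotangent vector with a tangent vector, in either written order.
\<close>

definition tangent_field :: "('e::lctvs \<Rightarrow> 'e) \<Rightarrow> bool" where
  "tangent_field K \<longleftrightarrow> smooth K"

definition linear_operator :: "('e::lctvs \<Rightarrow> 'e \<Rightarrow> 'f::lctvs) \<Rightarrow> bool" where
  "linear_operator \<Theta> \<longleftrightarrow> (\<forall>u. linear (\<Theta> u)) \<and> smooth (\<lambda>(u, S). \<Theta> u S)"

text \<open>
  \<open>op_gateaux \<Theta> u v\<close> is the operator \<open>\<Theta>'(u)[v]\<close>: the derivative of the operator-valued map
  \<open>\<Theta>\<close> is taken with its argument held fixed.
\<close>

definition op_gateaux :: "('e::lctvs \<Rightarrow> 'e \<Rightarrow> 'f::lctvs) \<Rightarrow> 'e \<Rightarrow> 'e \<Rightarrow> 'e \<Rightarrow> 'f" where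
  "op_gateaux \<Theta> u v = (\<lambda>T. gateaux (\<lambda>w. \<Theta> w T) u v)"

definition symplectic ::
  "('f::lctvs \<Rightarrow> 'e::lctvs \<Rightarrow> real) \<Rightarrow> ('e \<Rightarrow> 'e \<Rightarrow> 'f) \<Rightarrow> bool" where
  "symplectic p \<Theta> \<longleftrightarrow>
    linear_operator \<Theta> \<and>
    (\<forall>K S. tangent_field K \<and> tangent_field S \<longrightarrow>
      (\<forall>u. p (\<Theta> u (K u)) (S u) = - p (\<Theta> u (S u)) (K u))) \<and>
    (\<forall>K S T. tangent_field K \<and> tangent_field S \<and> tangent_field T \<longrightarrow>
      (\<forall>u. p (op_gateaux \<Theta> u (S u) (T u)) (K u)
         + p (op_gateaux \<Theta> u (T u) (K u)) (S u)
         + p (op_gateaux \<Theta> u (K u) (S u)) (T u) = 0))"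

definition hat_pairing :: "('f \<Rightarrow> 'e \<Rightarrow> real) \<Rightarrow> 'f ^ 'n \<Rightarrow> 'e ^ 'n \<Rightarrow> real" where
  "hat_pairing p \<xi> S = (\<Sum>a\<in>UNIV. p (\<xi> $ a) (S $ a))"

text \<open>
  An \<open>(N + 1)\<close>-tuple is an element of \<open>'e ^ 'n\<close>, where \<open>idx :: 'n \<Rightarrow> nat\<close> is a bijection
  from the index type onto \<open>{0..N}\<close>: the component \<open>\<eta> $ a\<close> is the \<open>idx a\<close>-th one.
\<close>

definition hat_u :: "('n \<Rightarrow> nat) \<Rightarrow> 'e::lctvs ^ 'n \<Rightarrow> real \<Rightarrow> 'e" where
  "hat_u idx \<eta> \<epsilon> = (\<Sum>a\<in>UNIV. \<epsilon> ^ idx a *\<^sub>R (\<eta> $ a))"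

text \<open>The block in row \<open>i\<close> and column \<open>j\<close>; as above, an operator is differentiated with its
  argument held fixed.\<close>

definition hat_block ::
  "nat \<Rightarrow> ('n \<Rightarrow> nat) \<Rightarrow> ('e::lctvs \<Rightarrow> 'e \<Rightarrow> 'f::lctvs) \<Rightarrow> 'e ^ 'n \<Rightarrow> nat \<Rightarrow> nat \<Rightarrow> 'e \<Rightarrow> 'f" where
  "hat_block N idx \<Theta> \<eta> i j =
    (if i + j > N then (\<lambda>S. 0)
     else (\<lambda>S. (1 / fact (N - i - j)) *\<^sub>R
             (curve_deriv ^^ (N - i - j)) (\<lambda>\<epsilon>. \<Theta> (hat_u idx \<eta> \<epsilon>) S) 0))"

definition hat_operator ::
  "nat \<Rightarrow> ('n \<Rightarrow> nat) \<Rightarrow> ('e::lctvs \<Rightarrow> 'e \<Rightarrow> 'f::lctvs) \<Rightarrow> 'e ^ 'n \<Rightarrow> 'e ^ 'n \<Rightarrow> 'f ^ 'n" where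
  "hat_operator N idx \<Theta> \<eta> S =
    (\<chi> a. \<Sum>b\<in>UNIV. hat_block N idx \<Theta> \<eta> (idx a) (idx b) (S $ b))"

end

theory Submission
  imports Defs
begin

text \<open>
  The entries of the lifted operator are Taylor coefficients at \<open>\<epsilon> = 0\<close> of the curve
  \<open>\<Theta>(u(\<epsilon>))\<close> with \<open>u(\<epsilon>) = \<eta>\<^sub>0 + \<epsilon> \<eta>\<^sub>1 + \<dots> + \<epsilon>\<^sup>N \<eta>\<^sub>N\<close>, so skew-symmetry is inherited coefficient by
  coefficient.  The \<open>\<epsilon>\<close>-derivatives commute with the derivative in \<open>\<eta>\<close>, and the latter in
  direction \<open>S\<close> is \<open>\<Theta>'(u(\<epsilon>))[\<Sum>c. \<epsilon>\<^sup>c S\<^sub>c]\<close>.  Hence \<open>\<langle>K, \<Theta>'[S] T\<rangle>\<close> for the lifted operator is the sum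
  over all \<open>a, b, c\<close> of the Taylor coefficient of order \<open>N - a - b - c\<close> of
  \<open>\<langle>K\<^sub>a, \<Theta>'(u(\<epsilon>))[S\<^sub>c] T\<^sub>b\<rangle>\<close>; the weights are symmetric in \<open>a, b, c\<close>, so the cyclic sum vanishes
  together with the one for \<open>\<Theta>\<close> at the points \<open>u(\<epsilon>)\<close>.

  In the absence of a norm, the calculus rests on the mean value theorem in the form that a
  difference quotient lies in every open convex set containing all the derivatives.
\<close>

subsection \<open>Limits in locally convex spaces\<close>

lemma tendsto_scaleR_lctvs [tendsto_intros]:
  fixes g :: "'a \<Rightarrow> 'b::lctvs"
  assumes "(f \<longlongrightarrow> a) F" "(g \<longlongrightarrow> x) F"
  shows "((\<lambda>t. f t *\<^sub>R g t) \<longlongrightarrow> a *\<^sub>R x) F"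
  using filterlim_compose[OF tendsto_scaleR_Pair filterlim_Pair[OF assms]] by simp

text \<open>Function types carry the product topology, so convergence is tested one argument at a
  time; this serves the sequences of directions in \<open>smooth\<close>.\<close>

lemma tendsto_fun:
  fixes w :: "'t \<Rightarrow> 'i \<Rightarrow> 'b::topological_space"
  assumes "\<And>i. ((\<lambda>t. w t i) \<longlongrightarrow> l i) F"
  shows "(w \<longlongrightarrow> l) F"
proof -
  have "limitin (product_topology (\<lambda>i. euclidean) UNIV) w l F"
    using assms by (simp add: limitin_componentwise limitin_canonical_iff)
  then show ?thesis
    by (simp add: euclidean_product_topology limitin_canonical_iff)
qed

text \<open>Translated to 0, a neighbourhood of the limit contains an open convex one by local
  convexity; translating back gives the set to test. Convex sets are what the mean value argument
  can handle.\<close>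

lemma tendsto_convexI:
  fixes L :: "'b::lctvs"
  assumes "\<And>V. open V \<Longrightarrow> convex V \<Longrightarrow> L \<in> V \<Longrightarrow> eventually (\<lambda>t. f t \<in> V) F"
  shows "(f \<longlongrightarrow> L) F"
proof (rule topological_tendstoI)
  fix S assume S: "open S" "L \<in> S"
  have shift: "open ((\<lambda>x. x + a) -` A)" if "open A" for A and a :: 'b
    using that by (intro open_vimage continuous_on_tendsto_compose)
      (auto simp: continuous_on_def intro!: tendsto_intros)
  obtain W where W: "open W" "0 \<in> W" "W \<subseteq> (\<lambda>x. x + L) -` S" "convex W"
    using locally_convex_0[of "(\<lambda>x. x + L) -` S"] shift[OF S(1), of L] S(2) by auto
  have eq: "(\<lambda>x. x + (- L)) -` W = (\<lambda>x. L + x) ` W"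
    by (force simp: image_iff)
  have "eventually (\<lambda>t. f t \<in> (\<lambda>x. x + (- L)) -` W) F"
  proof (rule assms)
    show "open ((\<lambda>x. x + (- L)) -` W)" by (rule shift[OF W(1)])
    show "convex ((\<lambda>x. x + (- L)) -` W)"
      unfolding eq by (rule convex_translation[OF W(4)])
  qed (use W in auto)
  then show "eventually (\<lambda>t. f t \<in> S) F"
    by eventually_elim (use W(3) in force)
qed

subsection \<open>Curves\<close>

text \<open>The relation carries existence of the limit along with its value, whereas
  \<open>curve_deriv\<close> is informative only once convergence is known.\<close>

definition has_curve_deriv :: "(real \<Rightarrow> 'a::lctvs) \<Rightarrow> 'a \<Rightarrow> real \<Rightarrow> bool" where
  "has_curve_deriv c d t \<longleftrightarrow> ((\<lambda>h. (c (t + h) - c t) /\<^sub>R h) \<longlongrightarrow> d) (at 0)"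

lemma curve_deriv_eqI: "has_curve_deriv c d t \<Longrightarrow> curve_deriv c t = d"
  unfolding has_curve_deriv_def curve_deriv_def by (intro tendsto_Lim) auto

lemma curve_differentiable_iff: "curve_differentiable c t \<longleftrightarrow> (\<exists>d. has_curve_deriv c d t)"
  unfolding has_curve_deriv_def curve_differentiable_def ..

lemma has_curve_deriv_unique:
  "has_curve_deriv c d t \<Longrightarrow> has_curve_deriv c d' t \<Longrightarrow> d = d'"
  using curve_deriv_eqI by blast

lemma has_curve_deriv_shift:
  "has_curve_deriv (\<lambda>s. c (a + s)) d t \<longleftrightarrow> has_curve_deriv c d (a + t)"
  unfolding has_curve_deriv_def by (simp add: add.assoc)

lemma has_curve_deriv_tendsto:
  assumes "has_curve_deriv c d t"
  shows "((\<lambda>h. c (t + h)) \<longlongrightarrow> c t) (at 0)"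
proof -
  have "((\<lambda>h. h *\<^sub>R ((c (t + h) - c t) /\<^sub>R h) + c t) \<longlongrightarrow> 0 *\<^sub>R d + c t) (at 0)"
    using assms unfolding has_curve_deriv_def by (intro tendsto_intros)
  moreover have "\<forall>\<^sub>F h in at 0. h *\<^sub>R ((c (t + h) - c t) /\<^sub>R h) + c t = c (t + h)"
    by (auto simp: eventually_at_filter)
  ultimately show ?thesis
    by (simp add: filterlim_cong)
qed

lemma has_curve_deriv_const: "has_curve_deriv (\<lambda>s. a) 0 t"
  by (simp add: has_curve_deriv_def)

lemma has_curve_deriv_ident: "has_curve_deriv (\<lambda>s. s) 1 (t :: real)"
proof -
  have "\<forall>\<^sub>F h in at 0. 1 = (t + h - t) /\<^sub>R h"
    by (auto simp: eventually_at_filter)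
  then show ?thesis
    unfolding has_curve_deriv_def by (rule Lim_transform_eventually[OF tendsto_const])
qed

lemma has_curve_deriv_add:
  assumes "has_curve_deriv c d t" "has_curve_deriv c' d' t"
  shows "has_curve_deriv (\<lambda>s. c s + c' s) (d + d') t"
  using tendsto_add[OF assms[unfolded has_curve_deriv_def]]
  by (simp add: has_curve_deriv_def algebra_simps)

lemma has_curve_deriv_sum:
  assumes "\<And>i. i \<in> I \<Longrightarrow> has_curve_deriv (c i) (d i) t"
  shows "has_curve_deriv (\<lambda>s. \<Sum>i\<in>I. c i s) (\<Sum>i\<in>I. d i) t"
  using assms
  by (induct I rule: infinite_finite_induct) (auto intro: has_curve_deriv_add has_curve_deriv_const)

lemma has_curve_deriv_sum_list:
  assumes "\<And>i. i \<in> set is \<Longrightarrow> has_curve_deriv (c i) (d i) t"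
  shows "has_curve_deriv (\<lambda>s. \<Sum>i\<leftarrow>is. c i s) (\<Sum>i\<leftarrow>is. d i) t"
  using assms
  by (induct "is") (auto intro: has_curve_deriv_add has_curve_deriv_const)

lemma has_curve_deriv_linear:
  assumes "linear L" "continuous_on UNIV L" "has_curve_deriv c d t"
  shows "has_curve_deriv (\<lambda>s. L (c s)) (L d) t"
  using continuous_on_tendsto_compose[OF assms(2) assms(3)[unfolded has_curve_deriv_def]]
  by (simp add: has_curve_deriv_def linear_diff[OF assms(1)] linear_cmul[OF assms(1)])

lemma has_curve_deriv_Pair:
  assumes "has_curve_deriv c d t" "has_curve_deriv c' d' t"
  shows "has_curve_deriv (\<lambda>s. (c s, c' s)) (d, d') t"
  using tendsto_Pair[OF assms[unfolded has_curve_deriv_def]]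
  by (simp add: has_curve_deriv_def scaleR_prod_def)

lemma has_curve_deriv_scaleR:
  assumes "has_curve_deriv r r' t" "has_curve_deriv c d t"
  shows "has_curve_deriv (\<lambda>s. r s *\<^sub>R c s) (r' *\<^sub>R c t + r t *\<^sub>R d) t"
proof -
  \<comment> \<open>The increment of \<open>r\<close> is paired with \<open>c (t + h)\<close>, so
    the limit uses the continuity of \<open>c\<close> at \<open>t\<close>.\<close>
  have "((\<lambda>h. ((r (t + h) - r t) /\<^sub>R h) *\<^sub>R c (t + h) + r t *\<^sub>R ((c (t + h) - c t) /\<^sub>R h))
      \<longlongrightarrow> r' *\<^sub>R c t + r t *\<^sub>R d) (at 0)"
    using assms has_curve_deriv_tendsto[OF assms(2)] unfolding has_curve_deriv_def
    by (intro tendsto_intros)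
  then show ?thesis
    unfolding has_curve_deriv_def by (simp add: algebra_simps)
qed

lemma has_curve_deriv_scaleR_time:
  assumes "has_curve_deriv c d (a * t)"
  shows "has_curve_deriv (\<lambda>s. c (a * s)) (a *\<^sub>R d) t"
\<comment> \<open>For \<open>a = 0\<close> the rescaled increment would not stay away from 0; the
  curve is then constant.\<close>
proof (cases "a = 0")
  case False
  have "filterlim (\<lambda>h. a * h) (at 0) (at (0 :: real))"
    using False by (auto intro!: filterlim_atI tendsto_eq_intros simp: eventually_at_filter)
  then have "((\<lambda>h. (c (a * t + a * h) - c (a * t)) /\<^sub>R (a * h)) \<longlongrightarrow> d) (at 0)"
    using filterlim_compose[OF assms[unfolded has_curve_deriv_def]] by blast
  then have "((\<lambda>h. a *\<^sub>R ((c (a * t + a * h) - c (a * t)) /\<^sub>R (a * h))) \<longlongrightarrow> a *\<^sub>R d) (at 0)"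
    by (intro tendsto_intros)
  moreover have "a *\<^sub>R (x /\<^sub>R (a * h)) = x /\<^sub>R h" for x :: 'a and h
    using False by simp
  ultimately show ?thesis
    by (simp only: has_curve_deriv_def distrib_left)
qed (simp add: has_curve_deriv_const)

text \<open>Membership of a difference quotient in a convex set passes from adjacent intervals to their
  union, so it suffices to check it locally.\<close>

lemma mean_value_convex:
  fixes c :: "real \<Rightarrow> 'a::lctvs"
  assumes "a < b" and V: "open V" "convex V"
    and der: "\<And>t. a \<le> t \<Longrightarrow> t \<le> b \<Longrightarrow> has_curve_deriv c (c' t) t \<and> c' t \<in> V"
  shows "(c b - c a) /\<^sub>R (b - a) \<in> V"
proof -
  \<comment> \<open>The guard makes degenerate intervals harmless in the bisection below.\<close>
  define P where "P s t \<longleftrightarrow> (s < t \<longrightarrow> (c t - c s) /\<^sub>R (t - s) \<in> V)" for s t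
  have trans: "P r t" if "P r s" "P s t" "r \<le> s" "s \<le> t" for r s t
  proof (cases "r < s \<and> s < t")
    case True
    \<comment> \<open>The quotient over the union is the average of the two quotients, weighted by
      relative length.\<close>
    then have "((s - r) / (t - r)) *\<^sub>R ((c s - c r) /\<^sub>R (s - r))
        + ((t - s) / (t - r)) *\<^sub>R ((c t - c s) /\<^sub>R (t - s)) \<in> V"
      using that
      by (intro convexD[OF V(2)]) (auto simp: P_def simp flip: add_divide_distrib)
    also have "((s - r) / (t - r)) *\<^sub>R ((c s - c r) /\<^sub>R (s - r))
        + ((t - s) / (t - r)) *\<^sub>R ((c t - c s) /\<^sub>R (t - s))
        = (1 / (t - r)) *\<^sub>R (c s - c r) + (1 / (t - r)) *\<^sub>R (c t - c s)"
    proof -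
      have "(s - r) / (t - r) * inverse (s - r) = 1 / (t - r)"
        "(t - s) / (t - r) * inverse (t - s) = 1 / (t - r)"
        using True by simp_all
      then show ?thesis by (simp only: scaleR_scaleR)
    qed
    also have "\<dots> = (c t - c r) /\<^sub>R (t - r)"
      by (simp add: scaleR_add_right[symmetric] divide_inverse)
    finally show ?thesis by (simp add: P_def)
  next
    case False
    then show ?thesis using that by (auto simp: P_def)
  qed
  have "P a b"
  \<comment> \<open>Bisection: a property that passes to unions of adjacent intervals and holds on
    all short intervals around each point holds on the whole interval.\<close>
  proof (rule Bolzano[of a b P])
    fix x assume x: "a \<le> x" "x \<le> b"
    then have "\<forall>\<^sub>F h in at 0. (c (x + h) - c x) /\<^sub>R h \<in> V"
      using der[OF x] V(1) unfolding has_curve_deriv_def by (auto dest: topological_tendstoD)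
    then obtain d where d: "d > 0" "\<And>h. h \<noteq> 0 \<Longrightarrow> \<bar>h\<bar> < d \<Longrightarrow> (c (x + h) - c x) /\<^sub>R h \<in> V"
      unfolding eventually_at by (auto simp: dist_real_def)
    \<comment> \<open>Only quotients based at \<open>x\<close> are known to lie in \<open>V\<close>,
      so the interval is cut at \<open>x\<close>.\<close>
    have "P s t" if "s \<le> x \<and> x \<le> t \<and> t - s < d" for s t
    proof (rule trans[of s x t])
      have "(c x - c s) /\<^sub>R (x - s) = (c (x + (s - x)) - c x) /\<^sub>R (s - x)"
        using scaleR_minus_left[of "inverse (x - s)" "c s - c x"]
        by (simp add: algebra_simps flip: inverse_minus_eq)
      then show "P s x"
        using d(2)[of "s - x"] that by (simp add: P_def)
      show "P x t"
        using d(2)[of "t - x"] that by (simp add: P_def)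
    qed (use that in auto)
    then show "\<exists>d>0. \<forall>s t. s \<le> x \<and> x \<le> t \<and> t - s < d \<longrightarrow> P s t"
      using d(1) by blast
  qed (use \<open>a < b\<close> trans in auto)
  then show ?thesis using \<open>a < b\<close> by (simp add: P_def)
qed

text \<open>The product filter brings the derivatives on the whole segment between 0 and
  \<open>h q\<close> close to \<open>L\<close> at once; the mean value theorem then puts the
  quotient into any given open convex set around \<open>L\<close>.\<close>

lemma tendsto_difference_quotient:
  fixes c :: "'p \<Rightarrow> real \<Rightarrow> 'a::lctvs"
  assumes der: "\<forall>\<^sub>F q in F. \<forall>s. has_curve_deriv (c q) (c' q s) s"
    and lim: "((\<lambda>(q, s). c' q s) \<longlongrightarrow> L) (F \<times>\<^sub>F nhds 0)"
    and h: "(h \<longlongrightarrow> 0) F" "\<forall>\<^sub>F q in F. h q \<noteq> 0"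
  shows "((\<lambda>q. (c q (h q) - c q 0) /\<^sub>R h q) \<longlongrightarrow> L) F"
proof (rule tendsto_convexI)
  fix V assume V: "open V" "convex V" "L \<in> V"
  from lim V have "\<forall>\<^sub>F (q, s) in F \<times>\<^sub>F nhds 0. c' q s \<in> V"
    by (auto dest!: topological_tendstoD simp: case_prod_unfold)
  then obtain P Q where P: "eventually P F" and Q: "eventually Q (nhds 0)"
    and PQ: "\<And>q s. P q \<Longrightarrow> Q s \<Longrightarrow> c' q s \<in> V"
    unfolding eventually_prod_filter by auto
  obtain d where d: "d > 0" "\<And>s. \<bar>s\<bar> < d \<Longrightarrow> Q s"
    using Q unfolding eventually_nhds_metric by (auto simp: dist_real_def)
  have "\<forall>\<^sub>F q in F. \<bar>h q\<bar> < d"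
    using tendstoD[OF h(1) d(1)] by (simp add: dist_real_def)
  then show "\<forall>\<^sub>F q in F. (c q (h q) - c q 0) /\<^sub>R h q \<in> V"
    using der h(2) P
  proof eventually_elim
    case (elim q)
    have in_V: "has_curve_deriv (c q) (c' q s) s \<and> c' q s \<in> V" if "\<bar>s\<bar> < d" for s
      using elim PQ d that by blast
    show ?case
    \<comment> \<open>The mean value theorem wants ordered endpoints; reversing the interval leaves
      the quotient unchanged.\<close>
    proof (cases "h q > 0")
      case True
      have "(c q (h q) - c q 0) /\<^sub>R (h q - 0) \<in> V"
        by (rule mean_value_convex[where c' = "c' q"]) (use True elim V in_V in auto)
      then show ?thesis by simp
    next
      case False
      have "(c q 0 - c q (h q)) /\<^sub>R (0 - h q) \<in> V"
        by (rule mean_value_convex[where c' = "c' q"]) (use False elim V in_V in auto)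
      then show ?thesis
        using scaleR_minus_left[of "inverse (h q)" "c q 0 - c q (h q)"] by (simp add: algebra_simps)
    qed
  qed
qed

subsection \<open>Iterated derivatives of smooth maps\<close>

text \<open>\<open>smooth\<close> speaks of the parameter value 0 only, but at every base point;
  sliding the base point along the line reaches every \<open>t\<close>.\<close>

lemma smooth_has_curve_deriv:
  assumes "smooth f"
  shows "has_curve_deriv (\<lambda>\<epsilon>. iter_gateaux f vs (u + \<epsilon> *\<^sub>R v)) (iter_gateaux f (v # vs) (u + t *\<^sub>R v)) t"
proof -
  have "has_curve_deriv (\<lambda>\<epsilon>. iter_gateaux f vs (w + \<epsilon> *\<^sub>R v)) (iter_gateaux f (v # vs) w) 0" for w
    using assms unfolding smooth_def curve_differentiable_iff
    by (auto simp: gateaux_def dest!: curve_deriv_eqI) (metis curve_deriv_eqI)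
  from this[of "u + t *\<^sub>R v"] show ?thesis
    using has_curve_deriv_shift[of "\<lambda>\<epsilon>. iter_gateaux f vs (u + \<epsilon> *\<^sub>R v)" t _ 0]
    by (simp add: algebra_simps)
qed

lemma smooth_has_curve_deriv_0:
  "smooth f \<Longrightarrow> has_curve_deriv (\<lambda>\<epsilon>. iter_gateaux f vs (u + \<epsilon> *\<^sub>R v)) (iter_gateaux f (v # vs) u) 0"
  using smooth_has_curve_deriv[of f vs u v 0] by simp

text \<open>Joint continuity is given for sequences of directions; a list of varying directions
  becomes one by padding with zeros, which \<open>[0..<length is]\<close> never reaches.\<close>

lemma tendsto_iter_gateaux:
  fixes f :: "'a::lctvs \<Rightarrow> 'b::lctvs"
  assumes f: "smooth f" and x: "(x \<longlongrightarrow> a) F"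
    and y: "\<And>i. i \<in> set is \<Longrightarrow> (y i \<longlongrightarrow> l i) F"
  shows "((\<lambda>t. iter_gateaux f (map (\<lambda>i. y i t) is) (x t)) \<longlongrightarrow> iter_gateaux f (map l is) a) F"
proof -
  define w where "w t j = (if j < length is then y (is ! j) t else 0)" for t j
  define b where "b j = (if j < length is then l (is ! j) else 0)" for j
  have "(w \<longlongrightarrow> b) F"
    by (rule tendsto_fun) (auto simp: w_def b_def intro!: y)
  then have "((\<lambda>t. (x t, w t)) \<longlongrightarrow> (a, b)) F"
    by (intro tendsto_Pair x)
  moreover have "continuous_on UNIV
      (\<lambda>(u, w :: nat \<Rightarrow> 'a). iter_gateaux f (map w [0..<length is]) u)"
    using f by (auto simp: smooth_def)
  ultimately have "((\<lambda>t. iter_gateaux f (map (w t) [0..<length is]) (x t))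
      \<longlongrightarrow> iter_gateaux f (map b [0..<length is]) a) F"
    using continuous_on_tendsto_compose[of UNIV _ "\<lambda>t. (x t, w t)" "(a, b)" F] by fastforce
  moreover have "map (w t) [0..<length is] = map (\<lambda>i. y i t) is" for t
    by (rule nth_equalityI) (auto simp: w_def)
  moreover have "map b [0..<length is] = map l is"
    by (rule nth_equalityI) (auto simp: b_def)
  ultimately show ?thesis by simp
qed

lemma tendsto_iter_gateaux_Cons:
  assumes "smooth f" "(x \<longlongrightarrow> a) F" "(v \<longlongrightarrow> b) F"
    and "\<And>i. i \<in> set is \<Longrightarrow> (y i \<longlongrightarrow> l i) F"
  shows "((\<lambda>t. iter_gateaux f (v t # map (\<lambda>i. y i t) is) (x t))
    \<longlongrightarrow> iter_gateaux f (b # map l is) a) F"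
proof -
  \<comment> \<open>The option type supplies a fresh index \<open>None\<close> for the extra
    direction.\<close>
  have "((\<lambda>t. iter_gateaux f (map (\<lambda>i. case_option v y i t) (None # map Some is)) (x t))
      \<longlongrightarrow> iter_gateaux f (map (case_option b l) (None # map Some is)) a) F"
    by (rule tendsto_iter_gateaux) (use assms in auto)
  then show ?thesis by (simp add: comp_def)
qed

text \<open>Pairing each direction with its own limit allows constant and varying directions to be
  mixed in one list.\<close>

lemma tendsto_iter_gateaux_list:
  assumes "smooth f" "(x \<longlongrightarrow> a) F" "\<And>c l. (c, l) \<in> set cs \<Longrightarrow> (c \<longlongrightarrow> l) F"
  shows "((\<lambda>t. iter_gateaux f (map (\<lambda>c. fst c t) cs) (x t)) \<longlongrightarrow> iter_gateaux f (map snd cs) a) F"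
  by (rule tendsto_iter_gateaux) (use assms in auto)

lemma tendsto_iter_gateaux_const:
  assumes "smooth f" "(x \<longlongrightarrow> a) F"
  shows "((\<lambda>t. iter_gateaux f vs (x t)) \<longlongrightarrow> iter_gateaux f vs a) F"
  using tendsto_iter_gateaux[OF assms, of vs "\<lambda>v _. v" "\<lambda>v. v"] by simp

lemma iter_gateaux_append: "iter_gateaux (iter_gateaux f ws) vs = iter_gateaux f (vs @ ws)"
  by (induct vs) simp_all

text \<open>Additivity in the direction, the product rule and the symmetry of second derivatives are all
  instances of this limit, because the base point, the direction and the parameters \<open>y i\<close> may
  vary together.\<close>

lemma tendsto_gateaux_quotient:
  fixes f :: "'a::lctvs \<Rightarrow> 'b::lctvs" and F :: "'p filter"
  assumes f: "smooth f" and x: "(x \<longlongrightarrow> a) F" and v: "(v \<longlongrightarrow> b) F"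
    and y: "\<And>i. i \<in> set is \<Longrightarrow> (y i \<longlongrightarrow> l i) F"
    and h: "(h \<longlongrightarrow> 0) F" "\<forall>\<^sub>F q in F. h q \<noteq> 0"
  shows "((\<lambda>q. (iter_gateaux f (map (\<lambda>i. y i q) is) (x q + h q *\<^sub>R v q)
      - iter_gateaux f (map (\<lambda>i. y i q) is) (x q)) /\<^sub>R h q)
      \<longlongrightarrow> iter_gateaux f (b # map l is) a) F"
proof -
  have "((\<lambda>q. (iter_gateaux f (map (\<lambda>i. y i q) is) (x q + h q *\<^sub>R v q)
      - iter_gateaux f (map (\<lambda>i. y i q) is) (x q + 0 *\<^sub>R v q)) /\<^sub>R h q)
      \<longlongrightarrow> iter_gateaux f (b # map l is) a) F"
  proof (rule tendsto_difference_quotient[OF _ _ h])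
    show "\<forall>\<^sub>F q in F. \<forall>s. has_curve_deriv (\<lambda>s. iter_gateaux f (map (\<lambda>i. y i q) is) (x q + s *\<^sub>R v q))
        (iter_gateaux f (v q # map (\<lambda>i. y i q) is) (x q + s *\<^sub>R v q)) s"
      using smooth_has_curve_deriv[OF f] by auto
    have 1: "filterlim fst F (F \<times>\<^sub>F nhds (0::real))" "filterlim snd (nhds (0::real)) (F \<times>\<^sub>F nhds 0)"
      by (rule filterlim_fst filterlim_snd)+
    have "((\<lambda>p. x (fst p) + snd p *\<^sub>R v (fst p)) \<longlongrightarrow> a + 0 *\<^sub>R b) (F \<times>\<^sub>F nhds 0)"
      by (intro tendsto_intros filterlim_compose[OF x] filterlim_compose[OF v] 1)
    then show "((\<lambda>(q, s). iter_gateaux f (v q # map (\<lambda>i. y i q) is) (x q + s *\<^sub>R v q))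
        \<longlongrightarrow> iter_gateaux f (b # map l is) a) (F \<times>\<^sub>F nhds 0)"
      unfolding case_prod_unfold
      by (intro tendsto_iter_gateaux_Cons f filterlim_compose[OF y] filterlim_compose[OF v] 1) auto
  qed
  then show ?thesis by simp
qed

text \<open>For additivity the increment is split at \<open>u + h *\<^sub>R v\<close>; the second
  quotient then has a moving base point, which the general limit permits. Homogeneity is a change of
  time scale.\<close>

lemma iter_gateaux_linear_Cons:
  assumes f: "smooth f"
  shows "linear (\<lambda>v. iter_gateaux f (v # vs) u)"
proof (rule linearI)
  fix v w
  have *: "filterlim (\<lambda>h. h) (nhds (0::real)) (at 0)" "\<forall>\<^sub>F h in at 0. h \<noteq> (0::real)"
    by (auto simp: eventually_at_filter tendsto_ident_at)
  have 1: "((\<lambda>h. (iter_gateaux f vs ((u + h *\<^sub>R v) + h *\<^sub>R w) - iter_gateaux f vs (u + h *\<^sub>R v)) /\<^sub>R h)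
      \<longlongrightarrow> iter_gateaux f (w # vs) u) (at 0)"
  proof -
    have "((\<lambda>h. u + h *\<^sub>R v) \<longlongrightarrow> u + 0 *\<^sub>R v) (at 0)"
      by (intro tendsto_intros)
    then show ?thesis
      using tendsto_gateaux_quotient[OF f _ tendsto_const _ *,
          of "\<lambda>h. u + h *\<^sub>R v" u vs "\<lambda>v _. v" "\<lambda>v. v" w] by simp
  qed
  have "((\<lambda>h. (iter_gateaux f vs (u + h *\<^sub>R v) - iter_gateaux f vs u) /\<^sub>R h)
      \<longlongrightarrow> iter_gateaux f (v # vs) u) (at 0)"
    using smooth_has_curve_deriv_0[OF f, of vs u v] by (simp add: has_curve_deriv_def)
  from tendsto_add[OF this 1]
  have "has_curve_deriv (\<lambda>\<epsilon>. iter_gateaux f vs (u + \<epsilon> *\<^sub>R (v + w)))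
      (iter_gateaux f (v # vs) u + iter_gateaux f (w # vs) u) 0"
    by (simp add: has_curve_deriv_def algebra_simps)
  then show "iter_gateaux f ((v + w) # vs) u = iter_gateaux f (v # vs) u + iter_gateaux f (w # vs) u"
    using has_curve_deriv_unique[OF smooth_has_curve_deriv_0[OF f]] by blast
next
  fix r :: real and v
  have "has_curve_deriv (\<lambda>\<epsilon>. iter_gateaux f vs (u + (r * \<epsilon>) *\<^sub>R v)) (r *\<^sub>R iter_gateaux f (v # vs) u) 0"
    using has_curve_deriv_scaleR_time[of "\<lambda>\<epsilon>. iter_gateaux f vs (u + \<epsilon> *\<^sub>R v)" _ r 0]
      smooth_has_curve_deriv_0[OF f] by simp
  then have "has_curve_deriv (\<lambda>\<epsilon>. iter_gateaux f vs (u + \<epsilon> *\<^sub>R (r *\<^sub>R v))) (r *\<^sub>R iter_gateaux f (v # vs) u) 0"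
    by (simp add: mult.commute)
  then show "iter_gateaux f ((r *\<^sub>R v) # vs) u = r *\<^sub>R iter_gateaux f (v # vs) u"
    using has_curve_deriv_unique[OF smooth_has_curve_deriv_0[OF f]] by blast
qed

text \<open>Directions applied after \<open>v\<close> merely differentiate an identity valid at all
  base points, so the outermost case propagates inwards.\<close>

lemma iter_gateaux_linear:
  assumes f: "smooth f"
  shows "linear (\<lambda>v. iter_gateaux f (xs @ v # ys) u)"
proof (induct xs arbitrary: u)
  case Nil
  show ?case using iter_gateaux_linear_Cons[OF f] by simp
next
  case (Cons x xs)
  note D = smooth_has_curve_deriv_0[OF f, of "xs @ _ # ys" u x]
  have "has_curve_deriv (\<lambda>\<epsilon>. iter_gateaux f (xs @ (v + w) # ys) (u + \<epsilon> *\<^sub>R x))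
      (iter_gateaux f (x # xs @ v # ys) u + iter_gateaux f (x # xs @ w # ys) u) 0" for v w
    using has_curve_deriv_add[OF D[of v] D[of w]] by (simp add: linear_add[OF Cons])
  moreover have "has_curve_deriv (\<lambda>\<epsilon>. iter_gateaux f (xs @ (r *\<^sub>R v) # ys) (u + \<epsilon> *\<^sub>R x))
      (r *\<^sub>R iter_gateaux f (x # xs @ v # ys) u) 0" for r v
    using has_curve_deriv_scaleR[OF has_curve_deriv_const[of r] D[of v]]
    by (simp add: linear_cmul[OF Cons])
  ultimately show ?case
    unfolding append_Cons by (intro linearI) (blast intro: has_curve_deriv_unique[OF D])+
qed

text \<open>Schwarz's argument: both mixed derivatives are limits of the same second difference
  quotient, which is symmetric in the two directions.\<close>

lemma gateaux_commute_iter: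
  assumes f: "smooth f"
  shows "iter_gateaux f (v # w # vs) u = iter_gateaux f (w # v # vs) u"
proof -
  define g where "g = iter_gateaux f vs"
  define \<Delta> where "\<Delta> h a b = ((g (u + h *\<^sub>R a + h *\<^sub>R b) - g (u + h *\<^sub>R a)) /\<^sub>R h
    - (g (u + h *\<^sub>R b) - g u) /\<^sub>R h) /\<^sub>R h" for h :: real and a b
  have lim: "((\<lambda>h. \<Delta> h a b) \<longlongrightarrow> iter_gateaux f (b # a # vs) u) (at 0)" for a b
  proof -
    \<comment> \<open>For fixed \<open>h\<close>, the second difference is a quotient in
      \<open>s\<close> of this curve; its \<open>s\<close>-derivative is a first quotient of the
      derivative along \<open>a\<close>, and that converges jointly in \<open>h\<close> and
      \<open>s\<close>.\<close>
    define c where "c h s = (g (u + s *\<^sub>R a + h *\<^sub>R b) - g (u + s *\<^sub>R a)) /\<^sub>R h" for h s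
    have "((\<lambda>h. (c h h - c h 0) /\<^sub>R h) \<longlongrightarrow> iter_gateaux f (b # a # vs) u) (at 0)"
    proof (rule tendsto_difference_quotient)
      show "\<forall>\<^sub>F h in at 0. \<forall>s. has_curve_deriv (c h)
          ((iter_gateaux f (a # vs) (u + s *\<^sub>R a + h *\<^sub>R b) - iter_gateaux f (a # vs) (u + s *\<^sub>R a)) /\<^sub>R h) s"
      proof (intro always_eventually allI)
        fix h s :: real
        have 1: "has_curve_deriv (\<lambda>s. g (u + s *\<^sub>R a + h *\<^sub>R b))
            (iter_gateaux f (a # vs) (u + s *\<^sub>R a + h *\<^sub>R b)) s"
          using smooth_has_curve_deriv[OF f, of vs "u + h *\<^sub>R b" a s] by (simp add: g_def add_ac)
        have "has_curve_deriv (\<lambda>s. inverse h *\<^sub>R (g (u + s *\<^sub>R a + h *\<^sub>R b) + (- 1) *\<^sub>R g (u + s *\<^sub>R a)))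
            (0 *\<^sub>R (g (u + s *\<^sub>R a + h *\<^sub>R b) + (- 1) *\<^sub>R g (u + s *\<^sub>R a)) + inverse h *\<^sub>R
              (iter_gateaux f (a # vs) (u + s *\<^sub>R a + h *\<^sub>R b) +
                (0 *\<^sub>R g (u + s *\<^sub>R a) + (- 1) *\<^sub>R iter_gateaux f (a # vs) (u + s *\<^sub>R a)))) s"
          by (intro has_curve_deriv_scaleR has_curve_deriv_const has_curve_deriv_add 1)
            (use smooth_has_curve_deriv[OF f] in \<open>simp add: g_def\<close>)
        then show "has_curve_deriv (c h)
          ((iter_gateaux f (a # vs) (u + s *\<^sub>R a + h *\<^sub>R b) - iter_gateaux f (a # vs) (u + s *\<^sub>R a)) /\<^sub>R h) s"
          by (simp add: c_def[abs_def])
      qed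
      have "filterlim fst (at 0) (at 0 \<times>\<^sub>F nhds (0::real))" "filterlim snd (nhds 0) (at (0::real) \<times>\<^sub>F nhds (0::real))"
        by (rule filterlim_fst filterlim_snd)+
      then have 1: "(fst \<longlongrightarrow> 0) (at 0 \<times>\<^sub>F nhds (0::real))"
          "\<forall>\<^sub>F p in at 0 \<times>\<^sub>F nhds (0::real). fst p \<noteq> (0::real)"
        and 2: "((\<lambda>p. u + snd p *\<^sub>R a) \<longlongrightarrow> u + 0 *\<^sub>R a) (at (0::real) \<times>\<^sub>F nhds (0::real))"
        by (auto simp: filterlim_at simp del: scaleR_zero_left intro!: tendsto_intros)
      show "((\<lambda>(h, s). (iter_gateaux f (a # vs) (u + s *\<^sub>R a + h *\<^sub>R b)
          - iter_gateaux f (a # vs) (u + s *\<^sub>R a)) /\<^sub>R h) \<longlongrightarrow> iter_gateaux f (b # a # vs) u) (at 0 \<times>\<^sub>F nhds 0)"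
        unfolding case_prod_unfold
        using tendsto_gateaux_quotient[OF f 2 tendsto_const _ 1,
            of "a # vs" "\<lambda>v _. v" "\<lambda>v. v" b] by simp
    qed (auto simp: eventually_at_filter tendsto_ident_at)
    then show ?thesis
      by (simp add: \<Delta>_def c_def)
  qed
  have "\<Delta> h v w = \<Delta> h w v" for h
    by (simp add: \<Delta>_def algebra_simps)
  then have "(\<lambda>h. \<Delta> h v w) = (\<lambda>h. \<Delta> h w v)" ..
  then show ?thesis
    using tendsto_unique[OF _ lim[of v w]] lim[of w v] by force
qed

text \<open>Chain and product rule together: the total increment telescopes into that of the base
  point and those of the single directions, the latter being linear slots.\<close>

lemma has_curve_deriv_iter_gateaux:
  fixes f :: "'a::lctvs \<Rightarrow> 'b::lctvs"
  assumes f: "smooth f" and x: "has_curve_deriv x x' 0"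
    and y: "\<And>i. i \<in> set is \<Longrightarrow> has_curve_deriv (y i) (y' i) 0"
  shows "has_curve_deriv (\<lambda>h. iter_gateaux f (map (\<lambda>i. y i h) is) (x h))
    (iter_gateaux f (x' # map (\<lambda>i. y i 0) is) (x 0)
      + (\<Sum>n<length is. iter_gateaux f ((map (\<lambda>i. y i 0) is)[n := y' (is ! n)]) (x 0))) 0"
proof -
  note id_tendsto = tendsto_ident_at[of "0 :: real" UNIV]
  have nz: "\<forall>\<^sub>F h in at 0. h \<noteq> (0 :: real)"
    by (simp add: eventually_at_filter)
  have y0: "(y i \<longlongrightarrow> y i 0) (at 0)" if "i \<in> set is" for i
    using has_curve_deriv_tendsto[OF y[OF that]] by simp
  define q where "q n h = (y (is ! n) h - y (is ! n) 0) /\<^sub>R h" for n h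
  \<comment> \<open>\<open>L n h\<close> has its first \<open>n\<close> directions at time
    \<open>h\<close> and the others at time 0; by linearity, the scaled step from
    \<open>L n h\<close> to \<open>L (Suc n) h\<close> is \<open>M n h\<close>.\<close>
  define L where "L n h = map (\<lambda>i. y i h) (take n is) @ map (\<lambda>i. y i 0) (drop n is)" for n h
  define M where "M n h = iter_gateaux f (map (\<lambda>i. y i h) (take n is) @ q n h # map (\<lambda>i. y i 0) (drop (Suc n) is)) (x 0)" for n h
  \<comment> \<open>For \<open>h\<close> nonzero this is the motion of the base point, written as a
    step along a direction that converges to \<open>x'\<close>.\<close>
  define B where "B h = (iter_gateaux f (map (\<lambda>i. y i h) is) (x 0 + h *\<^sub>R ((x h - x 0) /\<^sub>R h))
      - iter_gateaux f (map (\<lambda>i. y i h) is) (x 0)) /\<^sub>R h" for h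
  have step: "(iter_gateaux f (L (Suc n) h) (x 0) - iter_gateaux f (L n h) (x 0)) /\<^sub>R h = M n h"
    if "n < length is" for n h
  proof -
    note lin = iter_gateaux_linear[OF f, of "map (\<lambda>i. y i h) (take n is)" "map (\<lambda>i. y i 0) (drop (Suc n) is)" "x 0"]
    have "L (Suc n) h = map (\<lambda>i. y i h) (take n is) @ y (is ! n) h # map (\<lambda>i. y i 0) (drop (Suc n) is)"
      "L n h = map (\<lambda>i. y i h) (take n is) @ y (is ! n) 0 # map (\<lambda>i. y i 0) (drop (Suc n) is)"
      using that by (simp_all add: L_def take_Suc_conv_app_nth flip: Cons_nth_drop_Suc)
    then show ?thesis
      by (simp add: M_def q_def linear_cmul[OF lin] linear_diff[OF lin])
  qed
  have M: "(M n \<longlongrightarrow> iter_gateaux f ((map (\<lambda>i. y i 0) is)[n := y' (is ! n)]) (x 0)) (at 0)"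
    if n: "n < length is" for n
  proof -
    have q: "(q n \<longlongrightarrow> y' (is ! n)) (at 0)"
      using y[of "is ! n"] n by (simp add: has_curve_deriv_def q_def[abs_def])
    define cs where "cs = map (\<lambda>i. (y i, y i 0)) (take n is) @ (q n, y' (is ! n))
        # map (\<lambda>i. (\<lambda>h. y i 0, y i 0)) (drop (Suc n) is)"
    have "((\<lambda>t. iter_gateaux f (map (\<lambda>c. fst c t) cs) (x 0)) \<longlongrightarrow> iter_gateaux f (map snd cs) (x 0)) (at 0)"
      by (rule tendsto_iter_gateaux_list[OF f tendsto_const])
        (auto simp: cs_def q dest!: in_set_takeD intro: y0)
    then show ?thesis
      using n by (simp add: cs_def M_def[abs_def] comp_def upd_conv_take_nth_drop take_map drop_map)
  qed
  have "(B \<longlongrightarrow> iter_gateaux f (x' # map (\<lambda>i. y i 0) is) (x 0)) (at 0)"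
    unfolding B_def
    using x by (intro tendsto_gateaux_quotient[OF f tendsto_const] y0 id_tendsto nz)
      (auto simp: has_curve_deriv_def)
  then have "((\<lambda>h. B h + (\<Sum>n<length is. M n h)) \<longlongrightarrow> iter_gateaux f (x' # map (\<lambda>i. y i 0) is) (x 0)
      + (\<Sum>n<length is. iter_gateaux f ((map (\<lambda>i. y i 0) is)[n := y' (is ! n)]) (x 0))) (at 0)"
    by (intro tendsto_add tendsto_sum M) auto
  moreover have "\<forall>\<^sub>F h in at 0. B h + (\<Sum>n<length is. M n h)
      = (iter_gateaux f (map (\<lambda>i. y i (0 + h)) is) (x (0 + h)) - iter_gateaux f (map (\<lambda>i. y i 0) is) (x 0)) /\<^sub>R h"
    using nz
  proof eventually_elim
    case (elim h)
    have "(\<Sum>n<length is. M n h)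
        = (\<Sum>n<length is. iter_gateaux f (L (Suc n) h) (x 0) - iter_gateaux f (L n h) (x 0)) /\<^sub>R h"
      by (simp add: step scaleR_sum_right)
    also have "\<dots> = (iter_gateaux f (map (\<lambda>i. y i h) is) (x 0) - iter_gateaux f (map (\<lambda>i. y i 0) is) (x 0)) /\<^sub>R h"
      by (subst sum_lessThan_telescope) (simp add: L_def)
    finally show ?case
      using elim by (simp add: B_def algebra_simps)
  qed
  ultimately show ?thesis
    unfolding has_curve_deriv_def by (rule Lim_transform_eventually)
qed

subsection \<open>Closure properties of smooth maps\<close>

text \<open>A coinduction principle, up to finite sums: the sequence of directions keeps all orders of
  differentiation within one type, whereas the tangent map \<open>(u, v) \<mapsto> X'(u)[v]\<close> would change
  the domain at each step of an induction on the order.\<close>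

lemma smooth_coinduct:
  fixes X :: "'a::lctvs \<Rightarrow> 'b::lctvs" and \<A> :: "('a \<Rightarrow> (nat \<Rightarrow> 'a) \<Rightarrow> 'b) set"
  assumes X: "(\<lambda>u w. X u) \<in> \<A>"
    and cont: "\<And>A U W u w F. A \<in> \<A> \<Longrightarrow> (U \<longlongrightarrow> u) F \<Longrightarrow> (\<And>i. ((\<lambda>t. W t i) \<longlongrightarrow> w i) F)
      \<Longrightarrow> ((\<lambda>t :: 'a \<times> (nat \<Rightarrow> 'a). A (U t) (W t)) \<longlongrightarrow> A u w) F"
    and der: "\<And>A. A \<in> \<A> \<Longrightarrow> \<exists>Bs. set Bs \<subseteq> \<A> \<and>
      (\<forall>u w v. has_curve_deriv (\<lambda>\<epsilon>. A (u + \<epsilon> *\<^sub>R v) w) (\<Sum>B\<leftarrow>Bs. B u (case_nat v w)) 0)"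
  shows "smooth X"
proof -
  obtain D where D: "\<And>A. A \<in> \<A> \<Longrightarrow> set (D A) \<subseteq> \<A>"
    and hcd: "\<And>A u v w. A \<in> \<A> \<Longrightarrow>
      has_curve_deriv (\<lambda>\<epsilon>. A (u + \<epsilon> *\<^sub>R v) w) (\<Sum>B\<leftarrow>D A. B u (case_nat v w)) 0"
    using der by metis
  have hcd_sum: "has_curve_deriv (\<lambda>\<epsilon>. \<Sum>B\<leftarrow>Bs. B (u + \<epsilon> *\<^sub>R v) w)
      (\<Sum>B\<leftarrow>concat (map D Bs). B u (case_nat v w)) 0" if "set Bs \<subseteq> \<A>" for Bs u v w
  proof -
    have "(\<Sum>B\<leftarrow>concat (map D Bs). B u (case_nat v w)) = (\<Sum>A\<leftarrow>Bs. \<Sum>B\<leftarrow>D A. B u (case_nat v w))"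
      by (induct Bs) auto
    then show ?thesis
      using that by (auto intro!: has_curve_deriv_sum_list hcd)
  qed
  \<comment> \<open>Every iterated derivative is a finite sum of members of the family, so existence
    and continuity can be checked on the members.\<close>
  have rep: "\<exists>Bs. set Bs \<subseteq> \<A> \<and> (\<forall>u w. iter_gateaux X (map w [0..<k]) u = (\<Sum>B\<leftarrow>Bs. B u w))" for k
  proof (induct k)
    case 0
    show ?case by (rule exI[of _ "[\<lambda>u w. X u]"]) (simp add: X)
  next
    case (Suc k)
    then obtain Bs where Bs: "set Bs \<subseteq> \<A>"
      and eq: "\<And>w. iter_gateaux X (map w [0..<k]) = (\<lambda>u. \<Sum>B\<leftarrow>Bs. B u w)"
      by (auto simp: fun_eq_iff)
    have "iter_gateaux X (map w [0..<Suc k]) u = (\<Sum>B\<leftarrow>concat (map D Bs). B u w)" for u w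
    proof -
      \<comment> \<open>The head of the list is the outermost direction: the induction hypothesis is
        used for the shifted sequence, and \<open>case_nat\<close> puts \<open>w 0\<close> back in
        front.\<close>
      have "map w [0..<Suc k] = w 0 # map (w \<circ> Suc) [0..<k]"
        by (simp add: upt_conv_Cons del: upt_Suc flip: map_Suc_upt map_map)
      moreover have "case_nat (w 0) (w \<circ> Suc) = w"
        by (auto split: nat.split)
      ultimately show ?thesis
        using curve_deriv_eqI[OF hcd_sum[OF Bs, of u "w 0" "w \<circ> Suc"]]
        by (simp add: gateaux_def eq del: upt_Suc)
    qed
    then show ?case
      using Bs D by (intro exI[of _ "concat (map D Bs)"]) fastforce
  qed
  have "curve_differentiable (\<lambda>\<epsilon>. iter_gateaux X vs (u + \<epsilon> *\<^sub>R v)) 0" for vs u v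
  proof -
    obtain Bs where Bs: "set Bs \<subseteq> \<A>"
      and eq: "\<And>u w. iter_gateaux X (map w [0..<length vs]) u = (\<Sum>B\<leftarrow>Bs. B u w)"
      using rep by metis
    from eq[of "nth vs"] hcd_sum[OF Bs, of u v "nth vs"] show ?thesis
      by (auto simp: curve_differentiable_iff map_nth)
  qed
  moreover have "continuous_on UNIV (\<lambda>(u, w :: nat \<Rightarrow> 'a). iter_gateaux X (map w [0..<k]) u)" for k
  proof -
    obtain Bs where Bs: "set Bs \<subseteq> \<A>"
      and eq: "\<And>u w. iter_gateaux X (map w [0..<k]) u = (\<Sum>B\<leftarrow>Bs. B u w)"
      using rep by metis
    have "((\<lambda>p. \<Sum>B\<leftarrow>Bs. B (fst p) (snd p)) \<longlongrightarrow> (\<Sum>B\<leftarrow>Bs. B (fst z) (snd z))) (at z)" for z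
    proof -
      have "((\<lambda>p. snd p i) \<longlongrightarrow> snd z i) (at z)" for i
        by (rule continuous_on_tendsto_compose[OF continuous_on_product_coordinates])
          (auto intro: tendsto_intros)
      with Bs show ?thesis
        by (induct Bs) (auto intro!: tendsto_add cont tendsto_fst)
    qed
    then show ?thesis
      by (simp add: continuous_on_def case_prod_unfold eq)
  qed
  ultimately show ?thesis
    by (simp add: smooth_def)
qed

section \<open>Instances of the coinduction principle\<close>

lemma smooth_const: "smooth (\<lambda>u. c)"
  by (rule smooth_coinduct[where \<A> = "{\<lambda>u w. c, \<lambda>u w. 0}"])
    (auto intro!: exI[of _ "[]"] has_curve_deriv_const)

lemma smooth_linear:
  fixes L :: "'a::lctvs \<Rightarrow> 'b::lctvs"
  assumes L: "linear L" "continuous_on UNIV L"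
  shows "smooth L"
\<comment> \<open>The derivative along \<open>v\<close> is \<open>L v\<close>, which
  \<open>case_nat v w\<close> presents as \<open>L (w 0)\<close>; it does not depend on the point,
  so its own derivative is the empty sum.\<close>
proof (rule smooth_coinduct[where \<A> = "{\<lambda>u w. L u, \<lambda>u w. L (w 0)}"])
  fix A :: "'a \<Rightarrow> (nat \<Rightarrow> 'a) \<Rightarrow> 'b" and U :: "'a \<times> (nat \<Rightarrow> 'a) \<Rightarrow> 'a" and W :: "'a \<times> (nat \<Rightarrow> 'a) \<Rightarrow> nat \<Rightarrow> 'a" and u w F
  assume "A \<in> {\<lambda>u w. L u, \<lambda>u w. L (w 0)}" "(U \<longlongrightarrow> u) F" "\<And>i. ((\<lambda>t. W t i) \<longlongrightarrow> w i) F"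
  then show "((\<lambda>t. A (U t) (W t)) \<longlongrightarrow> A u w) F"
    by (auto intro!: continuous_on_tendsto_compose[OF L(2)])
next
  fix A :: "'a \<Rightarrow> (nat \<Rightarrow> 'a) \<Rightarrow> 'b"
  assume "A \<in> {\<lambda>u w. L u, \<lambda>u w. L (w 0)}"
  moreover have "has_curve_deriv (\<lambda>\<epsilon>. L (u + \<epsilon> *\<^sub>R v)) (L v) 0" for u v
  proof -
    have "has_curve_deriv (\<lambda>\<epsilon>. u + \<epsilon> *\<^sub>R v) (0 + (1 *\<^sub>R v + 0 *\<^sub>R 0)) 0"
      by (intro has_curve_deriv_add has_curve_deriv_scaleR has_curve_deriv_ident has_curve_deriv_const)
    from has_curve_deriv_linear[OF L this] show ?thesis by simp
  qed
  ultimately show "\<exists>Bs. set Bs \<subseteq> {\<lambda>u w. L u, \<lambda>u w. L (w 0)} \<and>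
      (\<forall>u w v. has_curve_deriv (\<lambda>\<epsilon>. A (u + \<epsilon> *\<^sub>R v) w) (\<Sum>B\<leftarrow>Bs. B u (case_nat v w)) 0)"
    by (elim insertE emptyE) (rule exI[of _ "[\<lambda>u w. L (w 0)]"], simp,
      rule exI[of _ "[]"], simp add: has_curve_deriv_const)
qed simp

text \<open>By Faa di Bruno's formula, derivatives of the composite are sums of derivatives of
  \<open>f\<close> at \<open>g z\<close> along derivatives of \<open>g\<close>; such terms are
  closed under differentiation.\<close>

lemma smooth_compose:
  fixes f :: "'b::lctvs \<Rightarrow> 'c::lctvs" and g :: "'a::lctvs \<Rightarrow> 'b"
  assumes f: "smooth f" and g: "smooth g"
  shows "smooth (\<lambda>z. f (g z))"
proof -
  \<comment> \<open>Each inner list \<open>js\<close> holds the positions in \<open>w\<close> of the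
    directions of one derivative of \<open>g\<close>.\<close>
  define A where "A jss z w = iter_gateaux f (map (\<lambda>js. iter_gateaux g (map w js) z) jss) (g z)"
    for jss :: "nat list list" and z :: 'a and w :: "nat \<Rightarrow> 'a"
  have g0: "iter_gateaux g [] = g" by simp
  show ?thesis
  proof (rule smooth_coinduct[where \<A> = "range A"])
    show "(\<lambda>u w. f (g u)) \<in> range A"
      by (rule range_eqI[of _ _ "[]"]) (simp add: A_def fun_eq_iff)
  next
    fix B and U :: "'a \<times> (nat \<Rightarrow> 'a) \<Rightarrow> 'a" and W :: "'a \<times> (nat \<Rightarrow> 'a) \<Rightarrow> nat \<Rightarrow> 'a" and u w F
    assume "B \<in> range A" "(U \<longlongrightarrow> u) F" "\<And>i. ((\<lambda>t. W t i) \<longlongrightarrow> w i) F"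
    then show "((\<lambda>t. B (U t) (W t)) \<longlongrightarrow> B u w) F"
      by (auto simp: A_def intro!: tendsto_iter_gateaux f g
          tendsto_iter_gateaux_const[OF g, where vs = "[]", unfolded g0])
  next
    fix B assume "B \<in> range A"
    then obtain jss where B: "B = A jss" by blast
    \<comment> \<open>The new direction takes position 0, so the old positions move up. The term
      \<open>[0] # kss\<close> comes from the base point \<open>g z\<close>, and
      \<open>nss n\<close> from the \<open>n\<close>-th inner derivative.\<close>
    define kss where "kss = map (map Suc) jss"
    define nss where "nss n = kss[n := 0 # map Suc (jss ! n)]" for n
    have "has_curve_deriv (\<lambda>\<epsilon>. B (u + \<epsilon> *\<^sub>R v) w)
        (\<Sum>B\<leftarrow>A ([0] # kss) # map (\<lambda>n. A (nss n)) [0..<length jss]. B u (case_nat v w)) 0" for u w v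
    proof -
      have "has_curve_deriv (\<lambda>\<epsilon>. A jss (u + \<epsilon> *\<^sub>R v) w)
        (iter_gateaux f (iter_gateaux g [v] u # map (\<lambda>js. iter_gateaux g (map w js) (u + 0 *\<^sub>R v)) jss) (g (u + 0 *\<^sub>R v))
        + (\<Sum>n<length jss. iter_gateaux f ((map (\<lambda>js. iter_gateaux g (map w js) (u + 0 *\<^sub>R v)) jss)
            [n := iter_gateaux g (v # map w (jss ! n)) u]) (g (u + 0 *\<^sub>R v)))) 0"
        unfolding A_def
        by (rule has_curve_deriv_iter_gateaux[OF f, where y' = "\<lambda>js. iter_gateaux g (v # map w js) u"])
          (rule smooth_has_curve_deriv_0[OF g, of "[]", unfolded g0] smooth_has_curve_deriv_0[OF g])+
      moreover have "A ([0] # kss) u (case_nat v w) =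
          iter_gateaux f (iter_gateaux g [v] u # map (\<lambda>js. iter_gateaux g (map w js) u) jss) (g u)"
        by (simp add: A_def kss_def comp_def)
      moreover have "A (nss n) u (case_nat v w) = iter_gateaux f ((map (\<lambda>js. iter_gateaux g (map w js) u) jss)
            [n := iter_gateaux g (v # map w (jss ! n)) u]) (g u)" for n
        by (simp add: A_def nss_def kss_def comp_def map_update)
      ultimately show ?thesis
        by (simp add: B comp_def interv_sum_list_conv_sum_set_nat atLeast0LessThan)
    qed
    then show "\<exists>Bs. set Bs \<subseteq> range A \<and>
        (\<forall>u w v. has_curve_deriv (\<lambda>\<epsilon>. B (u + \<epsilon> *\<^sub>R v) w) (\<Sum>B\<leftarrow>Bs. B u (case_nat v w)) 0)"
      by (intro exI[of _ "A ([0] # kss) # map (\<lambda>n. A (nss n)) [0..<length jss]"]) auto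
  qed
qed

lemma smooth_Pair:
  fixes f :: "'a::lctvs \<Rightarrow> 'b::lctvs" and g :: "'a \<Rightarrow> 'c::lctvs"
  assumes f: "smooth f" and g: "smooth g"
  shows "smooth (\<lambda>z. (f z, g z))"
proof -
  define A where "A js z w = (iter_gateaux f (map w js) z, iter_gateaux g (map w js) z)"
    for js :: "nat list" and z :: 'a and w :: "nat \<Rightarrow> 'a"
  show ?thesis
  proof (rule smooth_coinduct[where \<A> = "range A"])
    show "(\<lambda>u w. (f u, g u)) \<in> range A"
      by (rule range_eqI[of _ _ "[]"]) (simp add: A_def fun_eq_iff)
  next
    fix B and U :: "'a \<times> (nat \<Rightarrow> 'a) \<Rightarrow> 'a" and W :: "'a \<times> (nat \<Rightarrow> 'a) \<Rightarrow> nat \<Rightarrow> 'a" and u w F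
    assume "B \<in> range A" "(U \<longlongrightarrow> u) F" "\<And>i. ((\<lambda>t. W t i) \<longlongrightarrow> w i) F"
    then show "((\<lambda>t. B (U t) (W t)) \<longlongrightarrow> B u w) F"
      by (auto simp: A_def intro!: tendsto_Pair tendsto_iter_gateaux f g)
  next
    fix B assume "B \<in> range A"
    then obtain js where B: "B = A js" by blast
    have "has_curve_deriv (\<lambda>\<epsilon>. B (u + \<epsilon> *\<^sub>R v) w) (A (0 # map Suc js) u (case_nat v w)) 0" for u w v
      using has_curve_deriv_Pair[OF smooth_has_curve_deriv_0[OF f] smooth_has_curve_deriv_0[OF g], of "map w js" u v "map w js" u v]
      by (simp add: A_def B comp_def)
    then show "\<exists>Bs. set Bs \<subseteq> range A \<and>
        (\<forall>u w v. has_curve_deriv (\<lambda>\<epsilon>. B (u + \<epsilon> *\<^sub>R v) w) (\<Sum>B\<leftarrow>Bs. B u (case_nat v w)) 0)"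
      by (intro exI[of _ "[A (0 # map Suc js)]"]) auto
  qed
qed

lemma smooth_scaleR:
  fixes f :: "'a::lctvs \<Rightarrow> real" and g :: "'a \<Rightarrow> 'c::lctvs"
  assumes f: "smooth f" and g: "smooth g"
  shows "smooth (\<lambda>z. f z *\<^sub>R g z)"
proof -
  define A where "A is js z w = iter_gateaux f (map w is) z *\<^sub>R iter_gateaux g (map w js) z"
    for "is" js :: "nat list" and z :: 'a and w :: "nat \<Rightarrow> 'a"
  show ?thesis
  proof (rule smooth_coinduct[where \<A> = "range (case_prod A)"])
    show "(\<lambda>u w. f u *\<^sub>R g u) \<in> range (case_prod A)"
      by (rule range_eqI[of _ _ "([], [])"]) (simp add: A_def fun_eq_iff)
  next
    fix B and U :: "'a \<times> (nat \<Rightarrow> 'a) \<Rightarrow> 'a" and W :: "'a \<times> (nat \<Rightarrow> 'a) \<Rightarrow> nat \<Rightarrow> 'a" and u w F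
    assume "B \<in> range (case_prod A)" "(U \<longlongrightarrow> u) F" "\<And>i. ((\<lambda>t. W t i) \<longlongrightarrow> w i) F"
    then show "((\<lambda>t. B (U t) (W t)) \<longlongrightarrow> B u w) F"
      by (auto simp: A_def intro!: tendsto_scaleR_lctvs tendsto_iter_gateaux f g)
  next
    fix B assume "B \<in> range (case_prod A)"
    then obtain "is" js where B: "B = A is js" by auto
    have "has_curve_deriv (\<lambda>\<epsilon>. B (u + \<epsilon> *\<^sub>R v) w)
        (\<Sum>B\<leftarrow>[A (0 # map Suc is) (map Suc js), A (map Suc is) (0 # map Suc js)]. B u (case_nat v w)) 0" for u w v
      using has_curve_deriv_scaleR[OF smooth_has_curve_deriv_0[OF f] smooth_has_curve_deriv_0[OF g], of "map w is" u v "map w js" u v]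
      by (simp add: A_def B comp_def)
    moreover have "A is' js' \<in> range (case_prod A)" for is' js'
      by (rule range_eqI[of _ _ "(is', js')"]) simp
    ultimately show "\<exists>Bs. set Bs \<subseteq> range (case_prod A) \<and>
        (\<forall>u w v. has_curve_deriv (\<lambda>\<epsilon>. B (u + \<epsilon> *\<^sub>R v) w) (\<Sum>B\<leftarrow>Bs. B u (case_nat v w)) 0)"
      by (intro exI[of _ "[A (0 # map Suc is) (map Suc js), A (map Suc is) (0 # map Suc js)]"]) simp
  qed
qed

lemma smooth_iter_gateaux:
  fixes f :: "'a::lctvs \<Rightarrow> 'b::lctvs"
  assumes f: "smooth f"
  shows "smooth (iter_gateaux f vs)"
proof -
  \<comment> \<open>The fixed directions \<open>vs\<close> remain innermost while new ones are added
    in front.\<close>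
  define A where "A js z w = iter_gateaux f (map w js @ vs) z"
    for js :: "nat list" and z :: 'a and w :: "nat \<Rightarrow> 'a"
  show ?thesis
  proof (rule smooth_coinduct[where \<A> = "range A"])
    show "(\<lambda>u w. iter_gateaux f vs u) \<in> range A"
      by (rule range_eqI[of _ _ "[]"]) (simp add: A_def fun_eq_iff)
  next
    fix B and U :: "'a \<times> (nat \<Rightarrow> 'a) \<Rightarrow> 'a" and W :: "'a \<times> (nat \<Rightarrow> 'a) \<Rightarrow> nat \<Rightarrow> 'a" and u w F
    assume "B \<in> range A" and lim: "(U \<longlongrightarrow> u) F" "\<And>i. ((\<lambda>t. W t i) \<longlongrightarrow> w i) F"
    then obtain js where B: "B = A js" by auto
    define cs where "cs = map (\<lambda>j. (\<lambda>t. W t j, w j)) js @ map (\<lambda>v. (\<lambda>t. v, v)) vs"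
    have "((\<lambda>t. iter_gateaux f (map (\<lambda>c. fst c t) cs) (U t)) \<longlongrightarrow> iter_gateaux f (map snd cs) u) F"
      by (rule tendsto_iter_gateaux_list[OF f lim(1)]) (auto simp: cs_def lim(2))
    then show "((\<lambda>t. B (U t) (W t)) \<longlongrightarrow> B u w) F"
      by (simp add: A_def B cs_def comp_def)
  next
    fix B assume "B \<in> range A"
    then obtain js where B: "B = A js" by blast
    have "has_curve_deriv (\<lambda>\<epsilon>. B (u + \<epsilon> *\<^sub>R v) w) (A (0 # map Suc js) u (case_nat v w)) 0" for u w v
      using smooth_has_curve_deriv_0[OF f, of "map w js @ vs" u v]
      by (simp add: A_def B comp_def)
    then show "\<exists>Bs. set Bs \<subseteq> range A \<and>
        (\<forall>u w v. has_curve_deriv (\<lambda>\<epsilon>. B (u + \<epsilon> *\<^sub>R v) w) (\<Sum>B\<leftarrow>Bs. B u (case_nat v w)) 0)"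
      by (intro exI[of _ "[A (0 # map Suc js)]"]) auto
  qed
qed

lemma smooth_ident: "smooth (\<lambda>u. u)"
  by (rule smooth_linear) (auto intro: linear_ident)

lemma smooth_fst: "smooth f \<Longrightarrow> smooth (\<lambda>z. fst (f z))"
  by (rule smooth_compose[OF smooth_linear]) (auto intro: linear_fst continuous_on_fst)

lemma smooth_snd: "smooth f \<Longrightarrow> smooth (\<lambda>z. snd (f z))"
  by (rule smooth_compose[OF smooth_linear]) (auto intro: linear_snd continuous_on_snd)

lemma smooth_add:
  assumes "smooth f" "smooth g"
  shows "smooth (\<lambda>z. f z + g z)"
proof -
  have "smooth (\<lambda>p :: 'b \<times> 'b. fst p + snd p)"
    by (rule smooth_linear)
      (auto intro!: linearI continuous_on_add continuous_on_fst continuous_on_snd continuous_on_id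
        simp: algebra_simps)
  from smooth_compose[OF this smooth_Pair[OF assms]] show ?thesis by simp
qed

lemma smooth_sum:
  assumes "\<And>i. i \<in> I \<Longrightarrow> smooth (f i)"
  shows "smooth (\<lambda>z. \<Sum>i\<in>I. f i z)"
  using assms by (induct I rule: infinite_finite_induct) (auto intro: smooth_add smooth_const)

lemma linear_vec_nth_lctvs: "linear (\<lambda>x :: 'a::real_vector ^ 'n::finite. x $ i)"
  by (rule linearI) auto

lemma continuous_on_vec_nth_UNIV: "continuous_on UNIV (\<lambda>x :: 'a::topological_space ^ 'n::finite. x $ i)"
  by (auto simp: continuous_on_def intro: tendsto_vec_nth)

lemma smooth_vec_nth: "smooth f \<Longrightarrow> smooth (\<lambda>z. f z $ i)"
  by (rule smooth_compose[OF smooth_linear[OF linear_vec_nth_lctvs continuous_on_vec_nth_UNIV]])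

text \<open>A tuple is the sum of the axis embeddings of its entries, and these embeddings are
  linear and continuous.\<close>

lemma smooth_vec_lambda:
  fixes f :: "'n::finite \<Rightarrow> 'a::lctvs \<Rightarrow> 'b::lctvs"
  assumes "\<And>i. smooth (f i)"
  shows "smooth (\<lambda>z. \<chi> i. f i z)"
proof -
  have "smooth (axis i :: 'b \<Rightarrow> 'b ^ 'n)" for i
  proof (rule smooth_linear)
    show "linear (axis i :: 'b \<Rightarrow> 'b ^ 'n)"
      by (rule linearI) (auto simp: vec_eq_iff axis_def)
    have "((\<lambda>x :: 'b. \<chi> j. if j = i then x else 0) \<longlongrightarrow> (\<chi> j. if j = i then x else 0)) (at x)" for x
      by (rule tendsto_vec_lambda) (auto simp: tendsto_ident_at)
    then show "continuous_on UNIV (axis i :: 'b \<Rightarrow> 'b ^ 'n)"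
      by (auto simp: continuous_on_def axis_def)
  qed
  then have "smooth (\<lambda>z. \<Sum>i\<in>UNIV. axis i (f i z))"
    by (intro smooth_sum smooth_compose[OF _ assms])
  moreover have "(\<Sum>i\<in>UNIV. axis i (f i z)) = (\<chi> i. f i z)" for z
    by (simp add: vec_eq_iff sum_component axis_def)
  ultimately show ?thesis by simp
qed

lemma smooth_power_scaleR:
  assumes "smooth r" "smooth g"
  shows "smooth (\<lambda>z. r z ^ n *\<^sub>R g z)"
proof (induct n)
  case (Suc n)
  from smooth_scaleR[OF assms(1) this] show ?case by simp
qed (simp add: assms)

subsection \<open>Higher derivatives of curves\<close>

text \<open>Connects the \<open>\<epsilon>\<close>-derivatives in the blocks with directional
  derivatives, to which symmetry applies.\<close>

lemma higher_curve_deriv_line: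
  assumes "smooth f"
  shows "(curve_deriv ^^ k) (\<lambda>\<epsilon>. f (u + \<epsilon> *\<^sub>R v)) = (\<lambda>t. iter_gateaux f (replicate k v) (u + t *\<^sub>R v))"
proof (induct k)
  case (Suc k)
  then show ?case
    using curve_deriv_eqI[OF smooth_has_curve_deriv[OF assms, of "replicate k v" u v]] by auto
qed simp

lemma has_curve_deriv_higher:
  assumes "smooth c"
  shows "has_curve_deriv ((curve_deriv ^^ k) c) ((curve_deriv ^^ Suc k) c t) t"
proof -
  \<comment> \<open>A curve is its own restriction to the line through 0 in direction 1.\<close>
  have "(curve_deriv ^^ k) c = (\<lambda>t. iter_gateaux c (replicate k 1) t)" for k
    using higher_curve_deriv_line[OF assms, of k 0 1] by simp
  then show ?thesis
    using smooth_has_curve_deriv[OF assms, of "replicate k 1" 0 1 t] by (simp del: funpow.simps)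
qed

lemma higher_curve_deriv_linear:
  assumes "smooth c" "linear L" "continuous_on UNIV L"
  shows "(curve_deriv ^^ k) (\<lambda>t. L (c t)) = (\<lambda>t. L ((curve_deriv ^^ k) c t))"
proof (induct k)
  case (Suc k)
  then show ?case
    using curve_deriv_eqI[OF has_curve_deriv_linear[OF assms(2,3) has_curve_deriv_higher[OF assms(1)]]]
    by auto
qed simp

lemma higher_curve_deriv_scaleR:
  assumes "smooth c"
  shows "(curve_deriv ^^ k) (\<lambda>t. r *\<^sub>R c t) = (\<lambda>t. r *\<^sub>R (curve_deriv ^^ k) c t)"
  by (rule higher_curve_deriv_linear[OF assms])
    (auto intro!: linear_scaleR tendsto_intros simp: continuous_on_def)

lemma higher_curve_deriv_sum:
  assumes "\<And>i. i \<in> I \<Longrightarrow> smooth (c i)"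
  shows "(curve_deriv ^^ k) (\<lambda>t. \<Sum>i\<in>I. c i t) = (\<lambda>t. \<Sum>i\<in>I. (curve_deriv ^^ k) (c i) t)"
proof (induct k)
  case (Suc k)
  then show ?case
    using curve_deriv_eqI[OF has_curve_deriv_sum, of I "\<lambda>i. (curve_deriv ^^ k) (c i)"]
      has_curve_deriv_higher[OF assms] by fastforce
qed simp

lemma higher_curve_deriv_add:
  assumes "smooth c" "smooth d"
  shows "(curve_deriv ^^ k) (\<lambda>t. c t + d t) = (\<lambda>t. (curve_deriv ^^ k) c t + (curve_deriv ^^ k) d t)"
  using higher_curve_deriv_sum[of UNIV "\<lambda>b. if b then c else d" k] assms
  by (simp add: UNIV_bool add.commute)

lemma higher_curve_deriv_zero: "(curve_deriv ^^ k) (\<lambda>t. 0) = (\<lambda>t. 0)"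
  using higher_curve_deriv_sum[of "{}" _ k] by simp

text \<open>Leibniz's rule stops after two terms because the factor \<open>t\<close> has constant
  derivative. At \<open>m = 0\<close> the truncated \<open>m - 1\<close> is harmless: its
  coefficient is 0.\<close>

lemma higher_curve_deriv_ident_scaleR:
  assumes "smooth c"
  shows "(curve_deriv ^^ m) (\<lambda>t. t *\<^sub>R c t)
    = (\<lambda>t. t *\<^sub>R (curve_deriv ^^ m) c t + real m *\<^sub>R (curve_deriv ^^ (m - 1)) c t)"
proof (induct m)
  case (Suc m)
  note D = has_curve_deriv_higher[OF assms]
  have "has_curve_deriv (\<lambda>t. t *\<^sub>R (curve_deriv ^^ m) c t + real m *\<^sub>R (curve_deriv ^^ (m - 1)) c t)
      ((1 *\<^sub>R (curve_deriv ^^ m) c t + t *\<^sub>R (curve_deriv ^^ Suc m) c t)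
        + (0 *\<^sub>R (curve_deriv ^^ (m - 1)) c t + real m *\<^sub>R (curve_deriv ^^ Suc (m - 1)) c t)) t" for t
    by (intro has_curve_deriv_add has_curve_deriv_scaleR has_curve_deriv_ident has_curve_deriv_const D)
  note step = curve_deriv_eqI[OF this]
  show ?case
  proof (rule ext)
    fix t
    have "(curve_deriv ^^ Suc m) (\<lambda>t. t *\<^sub>R c t) t
        = curve_deriv (\<lambda>t. t *\<^sub>R (curve_deriv ^^ m) c t + real m *\<^sub>R (curve_deriv ^^ (m - 1)) c t) t"
      by (simp add: Suc)
    also have "\<dots> = t *\<^sub>R (curve_deriv ^^ Suc m) c t + real (Suc m) *\<^sub>R (curve_deriv ^^ (Suc m - 1)) c t"
      unfolding step by (cases m) (simp_all add: algebra_simps scaleR_2)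
    finally show "(curve_deriv ^^ Suc m) (\<lambda>t. t *\<^sub>R c t) t
        = t *\<^sub>R (curve_deriv ^^ Suc m) c t + real (Suc m) *\<^sub>R (curve_deriv ^^ (Suc m - 1)) c t" .
  qed
qed simp

text \<open>Each factor \<open>t\<close> shifts Taylor coefficients by one place, since
  \<open>m / fact m = 1 / fact (m - 1)\<close> for positive \<open>m\<close>.\<close>

lemma taylor_coeff_power_scaleR:
  assumes "smooth c"
  shows "(1 / fact m) *\<^sub>R (curve_deriv ^^ m) (\<lambda>t. t ^ j *\<^sub>R c t) 0
    = (if j \<le> m then (1 / fact (m - j)) *\<^sub>R (curve_deriv ^^ (m - j)) c 0 else 0)"
proof (induct j arbitrary: m)
  case (Suc j)
  have smooth: "smooth (\<lambda>t. t ^ j *\<^sub>R c t)"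
    by (intro smooth_power_scaleR smooth_ident assms)
  have "(curve_deriv ^^ m) (\<lambda>t. t ^ Suc j *\<^sub>R c t) 0
      = real m *\<^sub>R (curve_deriv ^^ (m - 1)) (\<lambda>t. t ^ j *\<^sub>R c t) 0"
    using higher_curve_deriv_ident_scaleR[OF smooth, of m] by simp
  moreover have "(1 / fact m) * real m = 1 / fact (m - 1)" if "m > 0"
    using that by (cases m) (auto simp: field_simps simp del: of_nat_Suc)
  ultimately show ?case
    using Suc[of "m - 1"] by (cases m) (auto simp del: fact_Suc)
qed simp

text \<open>Used to interchange the derivative in \<open>\<eta>\<close> with the repeated derivative
  in \<open>\<epsilon>\<close>.\<close>

lemma iter_gateaux_rotate:
  assumes "smooth f"
  shows "iter_gateaux f (v # replicate m e) = iter_gateaux f (replicate m e @ [v])"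
proof (induct m)
  case (Suc m)
  have "iter_gateaux f (v # e # replicate m e) = iter_gateaux f (e # v # replicate m e)"
    by (rule ext) (rule gateaux_commute_iter[OF assms])
  also have "\<dots> = iter_gateaux f (e # replicate m e @ [v])"
    by (subst (1 2) iter_gateaux.simps(2)) (simp only: Suc)
  finally show ?case by simp
qed simp

subsection \<open>The lifted operator\<close>

lemma hat_u_smooth:
  assumes "smooth f" "smooth r"
  shows "smooth (\<lambda>z. hat_u idx (f z) (r z))"
  unfolding hat_u_def by (intro smooth_sum smooth_power_scaleR smooth_vec_nth assms)

lemma hat_u_line: "hat_u idx (\<eta> + \<delta> *\<^sub>R S) \<epsilon> = hat_u idx \<eta> \<epsilon> + \<delta> *\<^sub>R hat_u idx S \<epsilon>"
  by (simp add: hat_u_def algebra_simps sum.distrib scaleR_sum_right)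

locale smooth_operator =
  fixes \<Theta> :: "'e::lctvs \<Rightarrow> 'e \<Rightarrow> 'f::lctvs" and N :: nat and idx :: "'n::finite \<Rightarrow> nat"
  assumes linear_operator: "linear_operator \<Theta>"
begin

lemma linear_apply: "linear (\<Theta> u)"
  using linear_operator by (simp add: linear_operator_def)

lemma smooth_apply:
  assumes "smooth f" "smooth g"
  shows "smooth (\<lambda>z. \<Theta> (f z) (g z))"
proof -
  have "smooth (\<lambda>(u, S). \<Theta> u S)"
    using linear_operator by (simp add: linear_operator_def)
  from smooth_compose[OF this smooth_Pair[OF assms]] show ?thesis by simp
qed

lemma smooth_fixed: "smooth (\<lambda>w. \<Theta> w T)"
  by (intro smooth_apply smooth_ident smooth_const)

lemma op_gateaux_eq: "op_gateaux \<Theta> u v T = iter_gateaux (\<lambda>w. \<Theta> w T) [v] u"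
  by (simp add: op_gateaux_def)

lemma smooth_op_gateaux: "smooth f \<Longrightarrow> smooth (\<lambda>z. op_gateaux \<Theta> (f z) v T)"
  unfolding op_gateaux_eq by (rule smooth_compose[OF smooth_iter_gateaux[OF smooth_fixed]])

text \<open>The blocks are partial derivatives of this map with respect to its first argument.\<close>

definition lift :: "real \<times> ('e ^ 'n) \<times> 'e \<Rightarrow> 'f" where
  "lift z = \<Theta> (hat_u idx (fst (snd z)) (fst z)) (snd (snd z))"

lemma smooth_lift: "smooth lift"
  unfolding lift_def
  by (intro smooth_apply hat_u_smooth smooth_fst smooth_snd smooth_ident)

text \<open>With \<open>\<epsilon>\<close>, \<open>\<eta>\<close> and \<open>S\<close> packed into
  one variable, varying \<open>\<epsilon>\<close> follows a line in direction
  \<open>(1, 0, 0)\<close>; joint smoothness of the blocks then comes from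
  \<open>smooth_iter_gateaux\<close>.\<close>

lemma higher_lift:
  "(curve_deriv ^^ m) (\<lambda>\<epsilon>. \<Theta> (hat_u idx \<eta> \<epsilon>) S) 0 = iter_gateaux lift (replicate m (1, 0, 0)) (0, \<eta>, S)"
  using higher_curve_deriv_line[OF smooth_lift, of m "(0, \<eta>, S)" "(1, 0, 0)"]
  by (simp add: lift_def)

lemma smooth_hat_block:
  assumes "smooth f" "smooth g"
  shows "smooth (\<lambda>z. hat_block N idx \<Theta> (f z) i j (g z))"
  unfolding hat_block_def higher_lift
  by (cases "i + j > N")
    (auto intro!: smooth_const smooth_scaleR smooth_Pair assms
      smooth_compose[OF smooth_iter_gateaux[OF smooth_lift]])

lemma smooth_curve: "smooth (\<lambda>\<epsilon>. \<Theta> (hat_u idx \<eta> \<epsilon>) S)"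
  by (intro smooth_apply hat_u_smooth smooth_const smooth_ident)

lemma linear_hat_block: "linear (hat_block N idx \<Theta> \<eta> i j)"
proof -
  have "linear (\<lambda>S. (curve_deriv ^^ m) (\<lambda>\<epsilon>. \<Theta> (hat_u idx \<eta> \<epsilon>) S) 0)" for m
    by (rule linearI) (simp_all add: linear_add[OF linear_apply] linear_cmul[OF linear_apply]
      higher_curve_deriv_add higher_curve_deriv_scaleR smooth_curve)
  then show ?thesis
    unfolding hat_block_def by (auto intro: linear_compose_scale_right linear_zero)
qed

lemma linear_operator_hat: "linear_operator (hat_operator N idx \<Theta>)"
  unfolding linear_operator_def
proof
  show "\<forall>\<eta>. linear (hat_operator N idx \<Theta> \<eta>)"
    by (auto intro!: linearI simp: vec_eq_iff hat_operator_def linear_add[OF linear_hat_block]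
        linear_cmul[OF linear_hat_block] sum.distrib scaleR_sum_right)
  show "smooth (\<lambda>(\<eta>, S). hat_operator N idx \<Theta> \<eta> S)"
    unfolding hat_operator_def case_prod_unfold
    by (intro smooth_vec_lambda smooth_sum smooth_hat_block smooth_fst smooth_snd smooth_vec_nth smooth_ident)
qed

lemma op_gateaux_hat_u:
  "op_gateaux \<Theta> u (hat_u idx S \<epsilon>) T = (\<Sum>c\<in>UNIV. \<epsilon> ^ idx c *\<^sub>R op_gateaux \<Theta> u (S $ c) T)"
proof -
  note lin = iter_gateaux_linear_Cons[OF smooth_fixed, of T "[]" u]
  show ?thesis
    by (simp only: op_gateaux_eq hat_u_def linear_sum[OF lin] linear_cmul[OF lin])
qed

text \<open>Row, column and direction indices enter the order only through their sum; this symmetry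
  drives the cyclic identity.\<close>

lemma gateaux_hat_block:
  "gateaux (\<lambda>\<eta>. hat_block N idx \<Theta> \<eta> i j T) \<eta> S
    = (\<Sum>c\<in>UNIV. if i + j + idx c \<le> N
        then (1 / fact (N - (i + j + idx c))) *\<^sub>R (curve_deriv ^^ (N - (i + j + idx c)))
          (\<lambda>\<epsilon>. op_gateaux \<Theta> (hat_u idx \<eta> \<epsilon>) (S $ c) T) 0
        else 0)"
proof (cases "i + j > N")
  case True
  then show ?thesis
    by (simp add: hat_block_def gateaux_def curve_deriv_eqI[OF has_curve_deriv_const])
next
  case False
  define m where "m = N - i - j"
  let ?e = "(1, 0, 0) :: real \<times> ('e ^ 'n) \<times> 'e" and ?S = "(0, S, 0) :: real \<times> ('e ^ 'n) \<times> 'e"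
  have lift_dir: "iter_gateaux lift [?S] (\<epsilon>, \<eta>, T) = op_gateaux \<Theta> (hat_u idx \<eta> \<epsilon>) (hat_u idx S \<epsilon>) T" for \<epsilon>
    by (simp add: gateaux_def op_gateaux_def lift_def hat_u_line)
  have smooth: "smooth (\<lambda>\<epsilon>. op_gateaux \<Theta> (hat_u idx \<eta> \<epsilon>) (S $ c) T)" for c
    by (intro smooth_op_gateaux hat_u_smooth smooth_const smooth_ident)
  have "has_curve_deriv (\<lambda>\<delta>. (1 / fact m) *\<^sub>R iter_gateaux lift (replicate m ?e) ((0, \<eta>, T) + \<delta> *\<^sub>R ?S))
      (0 *\<^sub>R iter_gateaux lift (replicate m ?e) ((0, \<eta>, T) + 0 *\<^sub>R ?S)
        + (1 / fact m) *\<^sub>R iter_gateaux lift (?S # replicate m ?e) (0, \<eta>, T)) 0"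
    by (intro has_curve_deriv_scaleR has_curve_deriv_const smooth_has_curve_deriv_0 smooth_lift)
  from curve_deriv_eqI[OF this]
  have "gateaux (\<lambda>\<eta>. hat_block N idx \<Theta> \<eta> i j T) \<eta> S
      = (1 / fact m) *\<^sub>R iter_gateaux lift (?S # replicate m ?e) (0, \<eta>, T)"
    using False by (simp add: gateaux_def hat_block_def higher_lift m_def del: iter_gateaux.simps)
  \<comment> \<open>Now the derivative along \<open>?S\<close> is taken first and the
    \<open>\<epsilon>\<close>-derivatives act on its result.\<close>
  also have "iter_gateaux lift (?S # replicate m ?e) (0, \<eta>, T)
      = iter_gateaux (iter_gateaux lift [?S]) (replicate m ?e) (0, \<eta>, T)"
    by (simp only: iter_gateaux_rotate[OF smooth_lift] iter_gateaux_append)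
  also have "\<dots> = (curve_deriv ^^ m) (\<lambda>\<epsilon>. iter_gateaux lift [?S] (\<epsilon>, \<eta>, T)) 0"
    using higher_curve_deriv_line[OF smooth_iter_gateaux[OF smooth_lift], of m "[?S]" "(0, \<eta>, T)" ?e]
    by (simp del: iter_gateaux.simps)
  also have "\<dots> = (\<Sum>c\<in>UNIV. (curve_deriv ^^ m) (\<lambda>\<epsilon>. \<epsilon> ^ idx c *\<^sub>R op_gateaux \<Theta> (hat_u idx \<eta> \<epsilon>) (S $ c) T) 0)"
    unfolding lift_dir op_gateaux_hat_u
    by (subst higher_curve_deriv_sum) (auto intro!: smooth_power_scaleR smooth_ident smooth)
  \<comment> \<open>The power \<open>\<epsilon> ^ idx c\<close> lowers the order of the Taylor
    coefficient by \<open>idx c\<close>, or annihilates it.\<close>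
  also have "(1 / fact m) *\<^sub>R \<dots> = (\<Sum>c\<in>UNIV. if idx c \<le> m
      then (1 / fact (m - idx c)) *\<^sub>R (curve_deriv ^^ (m - idx c))
        (\<lambda>\<epsilon>. op_gateaux \<Theta> (hat_u idx \<eta> \<epsilon>) (S $ c) T) 0 else 0)"
    by (simp only: scaleR_sum_right taylor_coeff_power_scaleR[OF smooth])
  also have "\<dots> = (\<Sum>c\<in>UNIV. if i + j + idx c \<le> N
        then (1 / fact (N - (i + j + idx c))) *\<^sub>R (curve_deriv ^^ (N - (i + j + idx c)))
          (\<lambda>\<epsilon>. op_gateaux \<Theta> (hat_u idx \<eta> \<epsilon>) (S $ c) T) 0
        else 0)"
  proof (rule sum.cong[OF refl])
    fix c
    have "idx c \<le> m \<longleftrightarrow> i + j + idx c \<le> N" "m - idx c = N - (i + j + idx c)"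
      using False by (auto simp: m_def)
    then show "(if idx c \<le> m
      then (1 / fact (m - idx c)) *\<^sub>R (curve_deriv ^^ (m - idx c))
        (\<lambda>\<epsilon>. op_gateaux \<Theta> (hat_u idx \<eta> \<epsilon>) (S $ c) T) 0 else 0) = (if i + j + idx c \<le> N
        then (1 / fact (N - (i + j + idx c))) *\<^sub>R (curve_deriv ^^ (N - (i + j + idx c)))
          (\<lambda>\<epsilon>. op_gateaux \<Theta> (hat_u idx \<eta> \<epsilon>) (S $ c) T) 0
        else 0)"
      by simp
  qed
  finally show ?thesis .
qed

lemma op_gateaux_hat_nth:
  "op_gateaux (hat_operator N idx \<Theta>) \<eta> S T $ a
    = (\<Sum>b\<in>UNIV. gateaux (\<lambda>\<eta>. hat_block N idx \<Theta> \<eta> (idx a) (idx b) (T $ b)) \<eta> S)"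
proof -
  have "smooth (\<lambda>\<eta>. hat_operator N idx \<Theta> \<eta> T)"
    unfolding hat_operator_def
    by (intro smooth_vec_lambda smooth_sum smooth_hat_block smooth_const smooth_ident)
  note has_curve_deriv_linear[OF linear_vec_nth_lctvs continuous_on_vec_nth_UNIV
      smooth_has_curve_deriv_0[OF this, of "[]" \<eta> S], of a]
  then have "has_curve_deriv (\<lambda>\<epsilon>. hat_operator N idx \<Theta> (\<eta> + \<epsilon> *\<^sub>R S) T $ a)
      (op_gateaux (hat_operator N idx \<Theta>) \<eta> S T $ a) 0"
    by (simp add: op_gateaux_def)
  moreover have "has_curve_deriv (\<lambda>\<epsilon>. hat_operator N idx \<Theta> (\<eta> + \<epsilon> *\<^sub>R S) T $ a)
      (\<Sum>b\<in>UNIV. gateaux (\<lambda>\<eta>. hat_block N idx \<Theta> \<eta> (idx a) (idx b) (T $ b)) \<eta> S) 0"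
    unfolding hat_operator_def vec_lambda_beta
  proof (rule has_curve_deriv_sum)
    fix b
    show "has_curve_deriv (\<lambda>\<epsilon>. hat_block N idx \<Theta> (\<eta> + \<epsilon> *\<^sub>R S) (idx a) (idx b) (T $ b))
      (gateaux (\<lambda>\<eta>. hat_block N idx \<Theta> \<eta> (idx a) (idx b) (T $ b)) \<eta> S) 0"
      using smooth_has_curve_deriv_0[OF smooth_hat_block[OF smooth_ident smooth_const], where vs = "[]"]
      by simp
  qed
  ultimately show ?thesis
    by (rule has_curve_deriv_unique)
qed

end

section \<open>Skew-symmetry and the cyclic identity for the lifted operator\<close>

lemma sum_rotate:
  "(\<Sum>a\<in>A. \<Sum>b\<in>B. \<Sum>c\<in>C. f c a b) = (\<Sum>c\<in>C. \<Sum>a\<in>A. \<Sum>b\<in>B. f c a b)"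
proof -
  have "(\<Sum>a\<in>A. \<Sum>b\<in>B. \<Sum>c\<in>C. f c a b) = (\<Sum>a\<in>A. \<Sum>c\<in>C. \<Sum>b\<in>B. f c a b)"
    by (intro sum.cong[OF refl] sum.swap)
  also have "\<dots> = (\<Sum>c\<in>C. \<Sum>a\<in>A. \<Sum>b\<in>B. f c a b)"
    by (rule sum.swap)
  finally show ?thesis .
qed

theorem theorem2p3:
  fixes p :: "'f::lctvs \<Rightarrow> 'e::lctvs \<Rightarrow> real"
    and \<Theta> :: "'e \<Rightarrow> 'e \<Rightarrow> 'f"
    and N :: nat
    and idx :: "'n::finite \<Rightarrow> nat"
  assumes "N \<ge> 1"
    and "bij_betw idx UNIV {0..N}"
    and "duality_pairing p"
    and "symplectic p \<Theta>"
  shows "symplectic (hat_pairing p) (hat_operator N idx \<Theta>)"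
proof -
  interpret smooth_operator \<Theta> N idx
    using assms(4) by unfold_locales (simp add: symplectic_def)
  have lin: "linear (\<lambda>\<xi>. p \<xi> S)" and cont: "continuous_on UNIV (\<lambda>\<xi>. p \<xi> S)" for S
    using assms(3) by (auto simp: duality_pairing_def bilinear_def)
  \<comment> \<open>Constant fields realise arbitrary vectors, so the identities for fields hold
    pointwise for vectors.\<close>
  have const: "tangent_field (\<lambda>_. K)" for K :: 'e
    by (simp add: tangent_field_def smooth_const)
  have "p (\<Theta> u (K u)) (S u) = - p (\<Theta> u (S u)) (K u)" if "tangent_field K" "tangent_field S" for u K S
    using assms(4) that unfolding symplectic_def by blast
  from this[OF const const] have skew: "p (\<Theta> u K) S = - p (\<Theta> u S) K" for u K S .
  have "p (op_gateaux \<Theta> u (S u) (T u)) (K u) + p (op_gateaux \<Theta> u (T u) (K u)) (S u)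
      + p (op_gateaux \<Theta> u (K u) (S u)) (T u) = 0"
    if "tangent_field K" "tangent_field S" "tangent_field T" for u K S T
    using assms(4) that unfolding symplectic_def by blast
  from this[OF const const const]
  have cyclic: "p (op_gateaux \<Theta> u S T) K + p (op_gateaux \<Theta> u T K) S + p (op_gateaux \<Theta> u K S) T = 0"
    for u K S T .
  have smooth_p: "smooth (\<lambda>t. p (c t) S)" if "smooth c" for c :: "real \<Rightarrow> 'f" and S
    using smooth_compose[OF smooth_linear[OF lin cont] that] .

  \<comment> \<open>Pairing with a fixed vector is linear and continuous, so it commutes with the
    \<open>\<epsilon>\<close>-derivatives; transposed blocks have the same order because
    \<open>i + j = j + i\<close>.\<close>
  have skew_block: "p (hat_block N idx \<Theta> \<eta> i j K) S = - p (hat_block N idx \<Theta> \<eta> j i S) K" for \<eta> i j K S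
  proof -
    have "p ((curve_deriv ^^ m) (\<lambda>\<epsilon>. \<Theta> (hat_u idx \<eta> \<epsilon>) K) 0) S
        = - p ((curve_deriv ^^ m) (\<lambda>\<epsilon>. \<Theta> (hat_u idx \<eta> \<epsilon>) S) 0) K" for m
    proof -
      have "p ((curve_deriv ^^ m) (\<lambda>\<epsilon>. \<Theta> (hat_u idx \<eta> \<epsilon>) K) 0) S
          = (curve_deriv ^^ m) (\<lambda>\<epsilon>. (- 1) *\<^sub>R p (\<Theta> (hat_u idx \<eta> \<epsilon>) S) K) 0"
        using higher_curve_deriv_linear[OF smooth_curve lin cont, of m \<eta> K S] skew[of _ K S] by simp
      also have "\<dots> = - p ((curve_deriv ^^ m) (\<lambda>\<epsilon>. \<Theta> (hat_u idx \<eta> \<epsilon>) S) 0) K"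
        by (simp only: higher_curve_deriv_scaleR[OF smooth_p[OF smooth_curve]]
            higher_curve_deriv_linear[OF smooth_curve lin cont]) simp
      finally show ?thesis .
    qed
    then show ?thesis
      by (simp add: hat_block_def linear_cmul[OF lin] linear_0[OF lin] add.commute diff_diff_left
          cong: if_cong)
  qed

  \<comment> \<open>The Taylor coefficient of order \<open>N - n\<close> at 0, with the explicit
    value 0 where the subtraction would truncate.\<close>
  define Y where "Y n \<phi> = (if n \<le> N then (1 / fact (N - n)) *\<^sub>R (curve_deriv ^^ (N - n)) \<phi> 0 else 0)"
    for n and \<phi> :: "real \<Rightarrow> real"
  define \<phi> where "\<phi> \<eta> S T K \<epsilon> = p (op_gateaux \<Theta> (hat_u idx \<eta> \<epsilon>) S T) K" for \<eta> S T K \<epsilon>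
  have smooth_op: "smooth (\<lambda>\<epsilon>. op_gateaux \<Theta> (hat_u idx \<eta> \<epsilon>) S T)" for \<eta> S T
    by (intro smooth_op_gateaux hat_u_smooth smooth_const smooth_ident)
  then have smooth_\<phi>: "smooth (\<phi> \<eta> S T K)" for \<eta> S T K
    unfolding \<phi>_def by (rule smooth_p)
  have expand: "hat_pairing p (op_gateaux (hat_operator N idx \<Theta>) \<eta> S T) K
      = (\<Sum>a\<in>UNIV. \<Sum>b\<in>UNIV. \<Sum>c\<in>UNIV. Y (idx a + idx b + idx c) (\<phi> \<eta> (S $ c) (T $ b) (K $ a)))" for \<eta> S T K
  proof -
    have "(curve_deriv ^^ m) (\<phi> \<eta> S T K) 0
        = p ((curve_deriv ^^ m) (\<lambda>\<epsilon>. op_gateaux \<Theta> (hat_u idx \<eta> \<epsilon>) S T) 0) K" for m S T K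
      using higher_curve_deriv_linear[OF smooth_op lin cont, of m \<eta> S T K]
      by (simp add: \<phi>_def[abs_def])
    then show ?thesis
      by (auto simp: hat_pairing_def op_gateaux_hat_nth gateaux_hat_block linear_sum[OF lin] Y_def
          linear_cmul[OF lin] linear_0[OF lin] intro!: sum.cong)
  qed
  \<comment> \<open>The three curves add up to zero for every \<open>\<epsilon>\<close>, by the
    identity for \<open>\<Theta>\<close> at the point
    \<open>hat_u idx \<eta> \<epsilon>\<close>.\<close>
  have Y_cyclic: "Y n (\<phi> \<eta> S T K) + Y n (\<phi> \<eta> T K S) + Y n (\<phi> \<eta> K S T) = 0" for n \<eta> S T K
  proof -
    have "(\<lambda>\<epsilon>. \<phi> \<eta> S T K \<epsilon> + \<phi> \<eta> T K S \<epsilon> + \<phi> \<eta> K S T \<epsilon>) = (\<lambda>\<epsilon>. 0)"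
      by (simp add: \<phi>_def cyclic)
    then have "(curve_deriv ^^ m) (\<phi> \<eta> S T K) 0 + (curve_deriv ^^ m) (\<phi> \<eta> T K S) 0
        + (curve_deriv ^^ m) (\<phi> \<eta> K S T) 0 = 0" for m
      using higher_curve_deriv_add[OF smooth_add[OF smooth_\<phi> smooth_\<phi>] smooth_\<phi>, of m \<eta> S T K \<eta> T K S \<eta> K S T]
      by (simp add: higher_curve_deriv_add smooth_\<phi> higher_curve_deriv_zero fun_eq_iff)
    from this[of "N - n"] show ?thesis
      by (auto simp: Y_def add_divide_distrib[symmetric])
  qed

  show ?thesis
    unfolding symplectic_def
  proof (intro conjI allI impI linear_operator_hat)
    fix K S :: "'e ^ 'n \<Rightarrow> 'e ^ 'n" and \<eta>
    have pair: "hat_pairing p (hat_operator N idx \<Theta> \<eta> K) S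
        = (\<Sum>a\<in>UNIV. \<Sum>b\<in>UNIV. p (hat_block N idx \<Theta> \<eta> (idx a) (idx b) (K $ b)) (S $ a))" for K S
      by (simp add: hat_pairing_def hat_operator_def linear_sum[OF lin])
    show "hat_pairing p (hat_operator N idx \<Theta> \<eta> (K \<eta>)) (S \<eta>)
        = - hat_pairing p (hat_operator N idx \<Theta> \<eta> (S \<eta>)) (K \<eta>)"
      unfolding pair sum_negf[symmetric] by (subst sum.swap) (intro sum.cong refl skew_block)
  next
    fix K S T :: "'e ^ 'n \<Rightarrow> 'e ^ 'n" and \<eta>
    let ?Y = "\<lambda>A B C a b c. Y (idx a + idx b + idx c) (\<phi> \<eta> (A \<eta> $ c) (B \<eta> $ b) (C \<eta> $ a))"
    \<comment> \<open>The summation indices are rotated until \<open>a\<close> belongs to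
      \<open>K\<close>, \<open>b\<close> to \<open>T\<close> and \<open>c\<close> to
      \<open>S\<close> in all three sums; the cyclic identity then holds term by term.\<close>
    have 2: "(\<Sum>a\<in>UNIV. \<Sum>b\<in>UNIV. \<Sum>c\<in>UNIV. ?Y T K S a b c) = (\<Sum>a\<in>UNIV. \<Sum>b\<in>UNIV. \<Sum>c\<in>UNIV. ?Y T K S c a b)"
      by (rule sum_rotate[symmetric])
    have 3: "(\<Sum>a\<in>UNIV. \<Sum>b\<in>UNIV. \<Sum>c\<in>UNIV. ?Y K S T a b c) = (\<Sum>a\<in>UNIV. \<Sum>b\<in>UNIV. \<Sum>c\<in>UNIV. ?Y K S T b c a)"
      by (rule sum_rotate)
    have "?Y S T K a b c + ?Y T K S c a b + ?Y K S T b c a = 0" for a b c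
      using Y_cyclic[of "idx a + idx b + idx c"] by (simp add: add_ac)
    then show "hat_pairing p (op_gateaux (hat_operator N idx \<Theta>) \<eta> (S \<eta>) (T \<eta>)) (K \<eta>)
        + hat_pairing p (op_gateaux (hat_operator N idx \<Theta>) \<eta> (T \<eta>) (K \<eta>)) (S \<eta>)
        + hat_pairing p (op_gateaux (hat_operator N idx \<Theta>) \<eta> (K \<eta>) (S \<eta>)) (T \<eta>) = 0"
      unfolding expand 2 3 by (simp flip: sum.distrib)
  qed
qed

end
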